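(* Let $s\ge 2$, let $\mathcal{L}\subset\mathbb{Z}^s$ be a lattice of rank $s-1$ generated by $a_1,\ldots,a_m$, let $L$ be the $s\times m$ matrix with columns $a_1,\ldots,a_m$, and let $P=(p_{i,j})$ and $Q$ be invertible integer matrices (invertible over $\mathbb{Z}$) such that $PLQ={\rm diag}(\gamma_1,\ldots,\gamma_{s-1},0,\ldots,0)$ is the Smith normal form of $L$, where $\gamma_i$ are positive integers with $\gamma_i\mid\gamma_j$ for $i\le j$. Let $\gamma=\gamma_1\cdots\gamma_{s-1}$. Let $K$ be a field containing the $\gamma_{s-1}$-th roots of unity, with ${\rm char}(K)=0$ or ${\rm char}(K)=p$, $p$ a prime with $p\nmid\gamma_{s-1}$, and let $S=K[t_1,\ldots,t_s]$. Suppose that the lattice ideal $I(\mathcal{L})\subset S$ (which has dimension $1$) is graded with respect to a weight vector $\mathbf{d}=(d_1,\ldots,d_s)$ of positive integers with $\gcd(\mathbf{d})=1$. Let $\Lambda_i$ be the set of $\gamma_i$-th roots of unity in $K$ and $\Lambda=\prod_{i=1}^{s-1}\Lambda_i$. For $\lambda=(\lambda_1,\ldots,\lambda_{s-1})\in\Lambda$ let $\mathfrak{a}_\lambda$ be the kernel of the $K$-algebra homomorphism $$\varphi_\lambda\colon S\to K[x_1],\qquad t_i\longmapsto \lambda_1^{p_{1,i}}\cdots\lambda_{s-1}^{p_{s-1,i}}\,x_1^{d_i},\quad i=1,\ldots,s.$$ Then $$I(\mathcal{L})=\bigcap_{\lambda\in\Lambda}\mathfrak{a}_\lambda$$ is the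 minimal primary decomposition of $I(\mathcal{L})$, into exactly $\gamma$ primary components.
   Context: A lattice is a subgroup $\mathcal{L}$ of $\mathbb{Z}^s$. For $a\in\mathbb{Z}^s$ write $a=a^+-a^-$ with $a^+,a^-\in\mathbb{N}^s$ of disjoint support, and $t^c=t_1^{c_1}\cdots t_s^{c_s}$. The lattice ideal of $\mathcal{L}$ over $K$ is $I(\mathcal{L})=(t^{a^+}-t^{a^-}\mid a\in\mathcal{L})\subset S$. The ideal is graded with respect to $\mathbf{d}$ if it is homogeneous for the grading of $S$ with $\deg t_i=d_i$. That $K$ contains the $\gamma_{s-1}$-th roots of unity means that $z^{\gamma_{s-1}}-1$ splits over $K$; by the assumption on the characteristic it then has $\gamma_{s-1}$ distinct roots in $K$. The dimension of an ideal $I$ is the Krull dimension of $S/I$. *)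

theory Defs
  imports
    "Jordan_Normal_Form.DL_Rank"
    "HOL-Algebra.Generated_Groups"
    "HOL-Algebra.RingHom"
    "HOL-Library.Poly_Mapping"
    "HOL-Computational_Algebra.Polynomial"
begin

section \<open>Conventions\<close>

text \<open>
  All indices are shifted to start at zero: the variables of \<open>S\<close>, the weights \<open>d\<close> and the rows
  of \<open>L\<close> are indexed by \<open>{..<s}\<close>, and the invariant factors \<open>\<gamma>\<close> and the tuples \<open>\<zeta>\<close> of roots of
  unity by \<open>{..<s - 1}\<close>. Thus the last invariant factor is \<open>\<gamma> (s - 2)\<close>.
\<close>


section \<open>Lattices\<close>

text \<open>The rank of a subgroup of \<open>\<int>\<^sup>s\<close> is the dimension of its rational span.\<close>

definition lattice_rank :: "nat \<Rightarrow> int vec set \<Rightarrow> nat" where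
  "lattice_rank s \<L> = vectorspace.dim class_ring
     (LinearCombinations.module.span_vs class_ring (module_vec TYPE(rat) s)
        (map_vec rat_of_int ` \<L>))"

definition smith_diag :: "nat \<Rightarrow> nat \<Rightarrow> (nat \<Rightarrow> nat) \<Rightarrow> int mat" where
  "smith_diag s m \<gamma> = mat s m (\<lambda>(i, j). if i = j \<and> i < s - 1 then int (\<gamma> i) else 0)"


section \<open>Polynomial rings in finitely many variables\<close>

text \<open>An exponent vector is a finitely supported map \<open>nat \<Rightarrow>\<^sub>0 nat\<close>.\<close>

type_synonym 'k mpoly = "(nat \<Rightarrow>\<^sub>0 nat) \<Rightarrow>\<^sub>0 'k"

definition mpoly_ring :: "nat \<Rightarrow> 'k::field mpoly ring" where
  "mpoly_ring s = \<lparr> carrier = {f. \<forall>c \<in> Poly_Mapping.keys f. Poly_Mapping.keys c \<subseteq> {..<s}},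
     mult = (*), one = 1, zero = 0, add = (+) \<rparr>"

lemma mpoly_ring_cring: "cring (mpoly_ring s :: 'k::field mpoly ring)"
proof -
  let ?C = "{f :: 'k mpoly. \<forall>c \<in> Poly_Mapping.keys f. Poly_Mapping.keys c \<subseteq> {..<s}}"
  have add: "f + g \<in> ?C" if "f \<in> ?C" "g \<in> ?C" for f g
    using that Poly_Mapping.keys_add[of f g] by blast
  have mul: "f * g \<in> ?C" if "f \<in> ?C" "g \<in> ?C" for f g
  proof (clarify)
    fix c x assume c: "c \<in> Poly_Mapping.keys (f * g)" and x: "x \<in> Poly_Mapping.keys c"
    from c obtain a b where "c = a + b" "a \<in> Poly_Mapping.keys f" "b \<in> Poly_Mapping.keys g"
      using Poly_Mapping.keys_mult[of f g] by blast
    then show "x < s"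
      using x that Poly_Mapping.keys_add[of a b] by fastforce
  qed
  have zero: "0 \<in> ?C" and one: "1 \<in> ?C" by auto
  have neg: "- f \<in> ?C" if "f \<in> ?C" for f
    using that by simp
  show ?thesis
  proof (rule cringI)
    show "abelian_group (mpoly_ring s :: 'k mpoly ring)"
    proof (rule abelian_groupI)
      fix f :: "'k mpoly" assume "f \<in> carrier (mpoly_ring s)"
      then show "\<exists>g\<in>carrier (mpoly_ring s). g \<oplus>\<^bsub>mpoly_ring s\<^esub> f = \<zero>\<^bsub>mpoly_ring s\<^esub>"
        using neg[of f] by (intro bexI[of _ "- f"]) (simp_all add: mpoly_ring_def)
    qed (use add zero in \<open>simp_all only: mpoly_ring_def ring.simps partial_object.simps
          monoid.simps ac_simps add_0_left add_0_right\<close>)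
    show "comm_monoid (mpoly_ring s :: 'k mpoly ring)"
      by (rule comm_monoidI)
        (use mul one in \<open>simp_all only: mpoly_ring_def partial_object.simps monoid.simps
          ac_simps mult_1_left mult_1_right\<close>)
  qed (simp only: mpoly_ring_def ring.simps monoid.simps distrib_right)
qed

definition monomial :: "(nat \<Rightarrow>\<^sub>0 nat) \<Rightarrow> 'k::field mpoly" where
  "monomial c = Poly_Mapping.single c 1"

text \<open>
  Substitution of \<open>g i\<close> for the variable \<open>t\<^sub>i\<close>, i.e. the unique homomorphism of
  \<open>K\<close>-algebras into \<open>K[x]\<close> with these values.
\<close>

definition mpoly_subst :: "(nat \<Rightarrow> 'k::field poly) \<Rightarrow> 'k mpoly \<Rightarrow> 'k poly" where
  "mpoly_subst g f = (\<Sum>c \<in> Poly_Mapping.keys f.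
     Polynomial.smult (Poly_Mapping.lookup f c)
       (\<Prod>i \<in> Poly_Mapping.keys c. g i ^ Poly_Mapping.lookup c i))"

definition weighted_degree :: "(nat \<Rightarrow> nat) \<Rightarrow> (nat \<Rightarrow>\<^sub>0 nat) \<Rightarrow> nat" where
  "weighted_degree d c = (\<Sum>i \<in> Poly_Mapping.keys c. d i * Poly_Mapping.lookup c i)"

definition homogeneous_part :: "(nat \<Rightarrow> nat) \<Rightarrow> nat \<Rightarrow> 'k::field mpoly \<Rightarrow> 'k mpoly" where
  "homogeneous_part d n f = (\<Sum>c \<in> {c \<in> Poly_Mapping.keys f. weighted_degree d c = n}.
     Poly_Mapping.single c (Poly_Mapping.lookup f c))"

definition graded_ideal :: "nat \<Rightarrow> (nat \<Rightarrow> nat) \<Rightarrow> 'k::field mpoly set \<Rightarrow> bool" where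
  "graded_ideal s d I \<longleftrightarrow> ideal I (mpoly_ring s) \<and> (\<forall>f\<in>I. \<forall>n. homogeneous_part d n f \<in> I)"


section \<open>The lattice ideal\<close>

text \<open>
  \<open>pos_part a\<close> is \<open>a\<^sup>+\<close>, since \<open>nat\<close> sends negative integers to zero; \<open>pos_part (- a)\<close> is \<open>a\<^sup>-\<close>.
\<close>

definition pos_part :: "int vec \<Rightarrow> (nat \<Rightarrow>\<^sub>0 nat)" where
  "pos_part a = (\<Sum>i<dim_vec a. Poly_Mapping.single i (nat (a $ i)))"

definition lattice_ideal :: "nat \<Rightarrow> int vec set \<Rightarrow> 'k::field mpoly set" where
  "lattice_ideal s \<L> =
     Idl\<^bsub>mpoly_ring s\<^esub> {monomial (pos_part a) - monomial (pos_part (- a)) | a. a \<in> \<L>}"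


section \<open>Roots of unity and the ideals of the parametrizations\<close>

definition contains_roots_of_unity :: "'k::field itself \<Rightarrow> nat \<Rightarrow> bool" where
  "contains_roots_of_unity TYPE('k) n \<longleftrightarrow>
     (\<exists>zs :: 'k list. [:0, 1:] ^ n - 1 = (\<Prod>z\<leftarrow>zs. [:- z, 1:]))"

definition roots_of_unity :: "nat \<Rightarrow> 'k::field set" where
  "roots_of_unity n = {z. z ^ n = 1}"

definition root_tuples :: "nat \<Rightarrow> (nat \<Rightarrow> nat) \<Rightarrow> (nat \<Rightarrow> 'k::field) set" where
  "root_tuples s \<gamma> = (\<Pi>\<^sub>E i\<in>{..<s - 1}. roots_of_unity (\<gamma> i))"

definition param_hom ::
    "nat \<Rightarrow> int mat \<Rightarrow> (nat \<Rightarrow> nat) \<Rightarrow> (nat \<Rightarrow> 'k::field) \<Rightarrow> 'k mpoly \<Rightarrow> 'k poly" where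
  "param_hom s P d \<zeta> =
     mpoly_subst (\<lambda>i. Polynomial.smult (\<Prod>j<s - 1. \<zeta> j powi (P $$ (j, i))) ([:0, 1:] ^ d i))"

definition param_ideal ::
    "nat \<Rightarrow> int mat \<Rightarrow> (nat \<Rightarrow> nat) \<Rightarrow> (nat \<Rightarrow> 'k::field) \<Rightarrow> 'k mpoly set" where
  "param_ideal s P d \<zeta> =
     a_kernel (mpoly_ring s) (class_ring :: 'k poly ring) (param_hom s P d \<zeta>)"


section \<open>Primary decompositions\<close>

definition ideal_radical :: "('a, 'b) ring_scheme \<Rightarrow> 'a set \<Rightarrow> 'a set" where
  "ideal_radical R I = {x \<in> carrier R. \<exists>n::nat. x [^]\<^bsub>R\<^esub> n \<in> I}"

definition primary_ideal :: "('a, 'b) ring_scheme \<Rightarrow> 'a set \<Rightarrow> bool" where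
  "primary_ideal R Q \<longleftrightarrow> ideal Q R \<and> Q \<noteq> carrier R \<and>
     (\<forall>x\<in>carrier R. \<forall>y\<in>carrier R. x \<otimes>\<^bsub>R\<^esub> y \<in> Q \<longrightarrow> x \<in> Q \<or> y \<in> ideal_radical R Q)"

text \<open>
  The intersections are taken inside \<open>carrier R\<close>, so that the empty family has intersection \<open>R\<close>.
\<close>

definition minimal_primary_decomposition ::
    "('a, 'b) ring_scheme \<Rightarrow> 'a set \<Rightarrow> 'i set \<Rightarrow> ('i \<Rightarrow> 'a set) \<Rightarrow> bool" where
  "minimal_primary_decomposition R I A q \<longleftrightarrow>
     finite A \<and> (\<forall>i\<in>A. primary_ideal R (q i)) \<and>
     I = carrier R \<inter> (\<Inter>i\<in>A. q i) \<and>
     inj_on (\<lambda>i. ideal_radical R (q i)) A \<and>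
     (\<forall>i\<in>A. \<not> carrier R \<inter> (\<Inter>j\<in>A - {i}. q j) \<subseteq> q i)"

end

theory Submission
  imports Defs
begin

text \<open>
  By the Smith normal form, \<open>a \<in> \<L>\<close> iff \<open>\<gamma>\<^sub>j\<close> divides \<open>(P a)\<^sub>j\<close> for \<open>j < s - 1\<close> and the last
  coordinate of \<open>P a\<close> vanishes; since \<open>d\<close> is orthogonal to \<open>\<L>\<close>, the last condition may be replaced
  by \<open>d \<cdot> a = 0\<close>. On a monomial \<open>t\<^sup>c\<close> the map \<open>\<phi>\<^sub>\<lambda>\<close> takes the value \<open>\<chi>\<^sub>\<lambda>(c) x\<close> to the
  power \<open>d \<cdot> c\<close>, where \<open>\<chi>\<^sub>\<lambda>(c) = \<Prod>\<^sub>j \<lambda>\<^sub>j\<close> to the power \<open>(P c)\<^sub>j\<close>. Thus if \<open>f\<close> lies in every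
  kernel, orthogonality of the characters \<open>\<lambda> \<mapsto> \<chi>\<^sub>\<lambda>(c)\<close> of the finite group \<open>\<Lambda>\<close> shows that the
  coefficients of \<open>f\<close> sum to zero over each class of exponents modulo \<open>\<L>\<close>, and then \<open>f\<close> is a
  combination of binomials of the lattice ideal. The kernels are primes, pairwise incomparable
  because the vectors dual to the first rows of \<open>P\<close> separate the characters; a finite intersection
  of incomparable primes has no other minimal primary decomposition.
\<close>

section \<open>Finite intersections of prime ideals\<close>

text \<open>Otherwise each \<open>q i\<close> has an element outside \<open>p\<close>; their product
  lies in every \<open>q i\<close> and, by primality, not in \<open>p\<close>. For empty
  \<open>A\<close> the claim rests on \<open>p\<close> being proper.\<close>

lemma (in cring) primeideal_INT_subset:
  assumes p: "primeideal p R" and "finite A" and q: "\<And>i. i \<in> A \<Longrightarrow> ideal (q i) R"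
    and sub: "carrier R \<inter> (\<Inter>i\<in>A. q i) \<subseteq> p"
  shows "\<exists>i\<in>A. q i \<subseteq> p"
proof (rule ccontr)
  interpret p: primeideal p R by fact
  assume "\<not> (\<exists>i\<in>A. q i \<subseteq> p)"
  then have "\<forall>i\<in>A. \<not> q i \<subseteq> p" by blast
  with \<open>finite A\<close> q have "\<exists>y\<in>carrier R \<inter> (\<Inter>i\<in>A. q i). y \<notin> p"
  proof (induction A)
    case empty
    then show ?case using p.I_notcarr p.a_subset by auto
  next
    case (insert i A)
    then obtain y where y: "y \<in> carrier R" "y \<in> (\<Inter>i\<in>A. q i)" "y \<notin> p" by auto
    obtain x where x: "x \<in> q i" "x \<notin> p" using insert.prems by blast
    have xR: "x \<in> carrier R" using ideal.Icarr[OF insert.prems(1) x(1)] by blast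
    have "x \<otimes> y \<in> q j" if "j \<in> insert i A" for j
      using that ideal.I_l_closed[OF insert.prems(1), of j y x]
        ideal.I_r_closed[OF insert.prems(1), of i x y] x y xR by auto
    moreover have "x \<otimes> y \<notin> p" using p.I_prime[of x y] x y xR by blast
    ultimately show ?case using xR y(1) by blast
  qed
  then show False using sub by blast
qed

lemma (in cring) ideal_radical_primeideal:
  assumes "primeideal p R"
  shows "ideal_radical R p = p"
proof -
  interpret p: primeideal p R by fact
  \<comment> \<open>Covers exponent 0, which \<open>ideal_radical\<close> allows.\<close>
  have one: "\<one> \<notin> p" using p.one_imp_carrier p.I_notcarr by auto
  have "x \<in> p" if "x \<in> carrier R" "x [^] n \<in> p" for x and n :: nat
    using that(2) by (induction n) (use one that(1) p.I_prime[of "x [^] _" x] in auto)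
  moreover have "x \<in> carrier R \<and> x [^] (1::nat) \<in> p" if "x \<in> p" for x
    using p.Icarr[OF that] that by simp
  ultimately show ?thesis unfolding ideal_radical_def by blast
qed

lemma (in cring) primary_ideal_primeideal:
  assumes "primeideal p R"
  shows "primary_ideal R p"
proof -
  interpret p: primeideal p R by fact
  show ?thesis
    using p.I_notcarr p.I_prime p.ideal_axioms
    unfolding primary_ideal_def ideal_radical_primeideal[OF assms] by blast
qed

text \<open>Primes are their own radicals, so incomparability gives distinct radicals at once, and
  irredundancy because a prime containing a finite intersection contains one of its members.\<close>

lemma (in cring) minimal_primary_decomposition_primeideals:
  assumes fin: "finite A" and p: "\<And>i. i \<in> A \<Longrightarrow> primeideal (p i) R"
    and incomp: "\<And>i j. i \<in> A \<Longrightarrow> j \<in> A \<Longrightarrow> p i \<subseteq> p j \<Longrightarrow> i = j"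
  shows "minimal_primary_decomposition R (carrier R \<inter> (\<Inter>i\<in>A. p i)) A p"
proof -
  have "\<not> carrier R \<inter> (\<Inter>j\<in>A - {i}. p j) \<subseteq> p i" if i: "i \<in> A" for i
  proof
    assume "carrier R \<inter> (\<Inter>j\<in>A - {i}. p j) \<subseteq> p i"
    then obtain j where "j \<in> A - {i}" "p j \<subseteq> p i"
      using primeideal_INT_subset[OF p[OF i], of "A - {i}" p] fin p primeideal.axioms(1) by blast
    then show False using incomp i by blast
  qed
  moreover have "inj_on (\<lambda>i. ideal_radical R (p i)) A"
    by (rule inj_onI) (metis ideal_radical_primeideal p incomp order_refl)
  ultimately show ?thesis
    unfolding minimal_primary_decomposition_def using fin p primary_ideal_primeideal by blast
qed

text \<open>Each \<open>p i\<close> contains some component \<open>q\<close>, and an element lying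
  in all the other primes but not in \<open>p i\<close> forces \<open>q\<close> to equal
  \<open>p i\<close>. Any component beyond these would be redundant.\<close>

lemma (in cring) minimal_primary_decomposition_unique:
  assumes fin: "finite A" and p: "\<And>i. i \<in> A \<Longrightarrow> primeideal (p i) R"
    and incomp: "\<And>i j. i \<in> A \<Longrightarrow> j \<in> A \<Longrightarrow> p i \<subseteq> p j \<Longrightarrow> i = j"
    and \<Q>: "minimal_primary_decomposition R (carrier R \<inter> (\<Inter>i\<in>A. p i)) \<Q> (\<lambda>q. q)"
  shows "\<Q> = p ` A"
proof -
  let ?I = "carrier R \<inter> (\<Inter>i\<in>A. p i)"
  have primary: "\<And>q. q \<in> \<Q> \<Longrightarrow> primary_ideal R q" and finQ: "finite \<Q>"
    and I: "?I = carrier R \<inter> (\<Inter>q\<in>\<Q>. q)"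
    and irredundant: "\<And>q. q \<in> \<Q> \<Longrightarrow> \<not> carrier R \<inter> (\<Inter>q'\<in>\<Q> - {q}. q') \<subseteq> q"
    using \<Q> unfolding minimal_primary_decomposition_def by blast+
  have mem: "p i \<in> \<Q>" if i: "i \<in> A" for i
  proof -
    interpret pi: primeideal "p i" R by (rule p[OF i])
    obtain q where q: "q \<in> \<Q>" "q \<subseteq> p i"
      using primeideal_INT_subset[OF p[OF i] finQ, of "\<lambda>q. q"] primary I i
      unfolding primary_ideal_def by blast
    have "minimal_primary_decomposition R ?I A p"
      by (rule minimal_primary_decomposition_primeideals[OF fin p incomp])
    then have "\<not> carrier R \<inter> (\<Inter>j\<in>A - {i}. p j) \<subseteq> p i"
      unfolding minimal_primary_decomposition_def using i by (elim conjE) (erule bspec)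
    \<comment> \<open>For \<open>x\<close> in \<open>p i\<close> the product with \<open>y\<close>
      lies in every prime, hence in \<open>q\<close>. No power of \<open>y\<close> is in
      \<open>q\<close>, since \<open>q\<close> lies in the prime \<open>p i\<close>; so primariness
      puts \<open>x\<close> in \<open>q\<close>.\<close>
    then obtain y where y: "y \<in> carrier R" "\<And>j. j \<in> A \<Longrightarrow> j \<noteq> i \<Longrightarrow> y \<in> p j" "y \<notin> p i"
      by blast
    have "x \<in> q" if x: "x \<in> p i" for x
    proof -
      have xR: "x \<in> carrier R" using pi.Icarr[OF x] .
      have "x \<otimes> y \<in> p j" if "j \<in> A" for j
        using that x xR y pi.I_r_closed[OF x y(1)] primeideal.axioms(1)[OF p[OF that]]
          ideal.I_l_closed[of "p j" R y x] by (cases "j = i") auto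
      then have "x \<otimes> y \<in> q" using I q(1) xR y(1) by auto
      moreover have "y \<notin> ideal_radical R q"
        using y(3) q(2) ideal_radical_primeideal[OF p[OF i]] unfolding ideal_radical_def by blast
      ultimately show ?thesis using primary[OF q(1)] xR y(1) unfolding primary_ideal_def by blast
    qed
    then show ?thesis using q by (metis subset_antisym subsetI)
  qed
  moreover have "q \<in> p ` A" if q: "q \<in> \<Q>" for q
  proof (rule ccontr)
    assume "q \<notin> p ` A"
    then have "carrier R \<inter> (\<Inter>q'\<in>\<Q> - {q}. q') \<subseteq> ?I" using mem by blast
    moreover have "?I \<subseteq> q" using I q by blast
    ultimately have "carrier R \<inter> (\<Inter>q'\<in>\<Q> - {q}. q') \<subseteq> q" by (rule order_trans)
    then show False using irredundant[OF q] by contradiction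
  qed
  ultimately show ?thesis by blast
qed

text \<open>Applied to the parametrizations, and also to the evaluation of all variables at
  1.\<close>

lemma (in ring_hom_cring) primeideal_a_kernel:
  assumes "domain S"
  shows "primeideal (a_kernel R S h) R"
proof (rule primeidealI)
  interpret D: domain S by fact
  show "ideal (a_kernel R S h) R"
    by (intro ring_hom_ring.kernel_is_ideal ring_hom_ringI2 R.ring_axioms S.ring_axioms homh)
  show "cring R" by (rule R.is_cring)
  have "\<one> \<notin> a_kernel R S h"
    unfolding a_kernel_def' using hom_one D.one_not_zero by simp
  then show "carrier R \<noteq> a_kernel R S h" using R.one_closed by metis
  fix a b assume ab: "a \<in> carrier R" "b \<in> carrier R" "a \<otimes> b \<in> a_kernel R S h"
  then have "h a \<otimes>\<^bsub>S\<^esub> h b = \<zero>\<^bsub>S\<^esub>"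
    unfolding a_kernel_def' by simp
  then have "h a = \<zero>\<^bsub>S\<^esub> \<or> h b = \<zero>\<^bsub>S\<^esub>"
    using D.integral ab by simp
  then show "a \<in> a_kernel R S h \<or> b \<in> a_kernel R S h"
    using ab unfolding a_kernel_def' by blast
qed

section \<open>Substitution homomorphisms\<close>

text \<open>The inner product of \<open>mpoly_subst\<close>, isolated so that multiplicativity of
  the substitution reduces to additivity in the exponent.\<close>

definition subst_monomial :: "(nat \<Rightarrow> 'a::comm_monoid_mult) \<Rightarrow> (nat \<Rightarrow>\<^sub>0 nat) \<Rightarrow> 'a" where
  "subst_monomial g c = (\<Prod>i\<in>Poly_Mapping.keys c. g i ^ Poly_Mapping.lookup c i)"

lemma subst_monomial_superset:
  assumes "finite A" "Poly_Mapping.keys c \<subseteq> A"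
  shows "subst_monomial g c = (\<Prod>i\<in>A. g i ^ Poly_Mapping.lookup c i)"
  unfolding subst_monomial_def
  by (rule prod.mono_neutral_left) (use assms in \<open>auto simp: in_keys_iff\<close>)

lemma subst_monomial_add: "subst_monomial g (a + b) = subst_monomial g a * subst_monomial g b"
proof -
  let ?A = "Poly_Mapping.keys a \<union> Poly_Mapping.keys b"
  have "Poly_Mapping.keys (a + b) \<subseteq> ?A" by (rule Poly_Mapping.keys_add)
  then show ?thesis
    by (simp add: subst_monomial_superset[of ?A] lookup_add power_add prod.distrib)
qed

text \<open>Lets polynomials with different supports be summed over one common finite set and
  compared termwise.\<close>

lemma mpoly_subst_superset:
  assumes "finite A" "Poly_Mapping.keys f \<subseteq> A"
  shows "mpoly_subst g f
    = (\<Sum>c\<in>A. Polynomial.smult (Poly_Mapping.lookup f c) (subst_monomial g c))"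
  unfolding mpoly_subst_def subst_monomial_def
  by (rule sum.mono_neutral_left) (use assms in \<open>auto simp: in_keys_iff\<close>)

lemma mpoly_subst_add: "mpoly_subst g (f + h) = mpoly_subst g f + mpoly_subst g h"
proof -
  let ?A = "Poly_Mapping.keys f \<union> Poly_Mapping.keys h"
  have "Poly_Mapping.keys (f + h) \<subseteq> ?A" by (rule Poly_Mapping.keys_add)
  then show ?thesis
    by (simp add: mpoly_subst_superset[of ?A] lookup_add smult_add_left sum.distrib)
qed

lemma mpoly_subst_zero [simp]: "mpoly_subst g 0 = 0"
  by (simp add: mpoly_subst_def)

lemma mpoly_subst_uminus: "mpoly_subst g (- f) = - mpoly_subst g f"
  by (simp add: mpoly_subst_def sum_negf)

lemma mpoly_subst_diff: "mpoly_subst g (f - h) = mpoly_subst g f - mpoly_subst g h"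
  using mpoly_subst_add[of g f "- h"] by (simp add: mpoly_subst_uminus)

lemma mpoly_subst_sum: "mpoly_subst g (\<Sum>x\<in>A. f x) = (\<Sum>x\<in>A. mpoly_subst g (f x))"
  by (induction A rule: infinite_finite_induct) (simp_all add: mpoly_subst_add)

lemma mpoly_subst_single:
  "mpoly_subst g (Poly_Mapping.single c k) = Polynomial.smult k (subst_monomial g c)"
  by (simp add: mpoly_subst_def subst_monomial_def)

lemma poly_mapping_sum_single:
  "(\<Sum>c\<in>Poly_Mapping.keys f. Poly_Mapping.single c (Poly_Mapping.lookup f c)) = f"
  by (rule poly_mapping_eqI)
    (simp add: lookup_sum lookup_single when_def in_keys_iff)

lemma mpoly_subst_mult: "mpoly_subst g (f * h) = mpoly_subst g f * mpoly_subst g h"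
proof -
  have "f * h = (\<Sum>a\<in>Poly_Mapping.keys f. Poly_Mapping.single a (Poly_Mapping.lookup f a))
      * (\<Sum>b\<in>Poly_Mapping.keys h. Poly_Mapping.single b (Poly_Mapping.lookup h b))"
    by (simp only: poly_mapping_sum_single)
  also have "\<dots> = (\<Sum>a\<in>Poly_Mapping.keys f. \<Sum>b\<in>Poly_Mapping.keys h.
      Poly_Mapping.single (a + b) (Poly_Mapping.lookup f a * Poly_Mapping.lookup h b))"
    by (simp add: sum_product mult_single)
  also have "mpoly_subst g \<dots> = mpoly_subst g f * mpoly_subst g h"
    unfolding mpoly_subst_superset[OF finite_keys order_refl, of g f]
      mpoly_subst_superset[OF finite_keys order_refl, of g h]
    by (simp add: mpoly_subst_sum mpoly_subst_single subst_monomial_add sum_product mult_ac)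
  finally show ?thesis .
qed

lemma mpoly_subst_one: "mpoly_subst g 1 = 1"
  using mpoly_subst_single[of g 0 1] by (simp add: subst_monomial_def)

lemma ring_hom_cring_mpoly_subst:
  "ring_hom_cring (mpoly_ring s) (class_ring :: 'k::field poly ring) (mpoly_subst g)"
  by (intro ring_hom_cringI ring_hom_ringI2 mpoly_ring_cring class_cring.cring_axioms
      class_ring.ring_axioms cring.axioms(1))
    (auto simp: Ring.ring_hom_def mpoly_ring_def mpoly_subst_mult mpoly_subst_add mpoly_subst_one)

lemma domain_class_ring: "domain (class_ring :: 'a::idom ring)"
  by (intro domain.intro class_cring.cring_axioms domain_axioms.intro) auto

lemma mem_carrier_mpoly_ring:
  "f \<in> carrier (mpoly_ring s) \<longleftrightarrow> (\<forall>c\<in>Poly_Mapping.keys f. Poly_Mapping.keys c \<subseteq> {..<s})"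
  by (simp add: mpoly_ring_def)

lemma monomial_in_carrier_iff:
  "(monomial c :: 'k::field mpoly) \<in> carrier (mpoly_ring s) \<longleftrightarrow> Poly_Mapping.keys c \<subseteq> {..<s}"
  by (simp add: mem_carrier_mpoly_ring monomial_def)

lemma mem_a_kernel_mpoly_ring:
  "f \<in> a_kernel (mpoly_ring s) (class_ring :: 'k::field poly ring) h
    \<longleftrightarrow> f \<in> carrier (mpoly_ring s) \<and> h f = 0"
  unfolding a_kernel_def' by simp

section \<open>Lattices in Smith normal form\<close>

lemma mult_mat_vec_unit_vec:
  fixes A :: "'a::semiring_1 mat"
  assumes "A \<in> carrier_mat n m" "j < m"
  shows "A *\<^sub>v unit_vec m j = col A j"
  by (rule eq_vecI) (use assms in auto)

lemma m_inv_monoid_vec: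
  fixes v :: "'a::ab_group_add vec"
  assumes "v \<in> carrier_vec n"
  shows "inv\<^bsub>monoid_vec TYPE('a) n\<^esub> v = - v"
proof -
  interpret comm_group "monoid_vec TYPE('a) n" by (rule comm_group_vec)
  show ?thesis by (rule inv_equality) (use assms in \<open>auto simp: monoid_vec_simps\<close>)
qed

lemma subgroup_monoid_vec_smult_closed:
  fixes v :: "int vec"
  assumes H: "subgroup H (monoid_vec TYPE(int) n)" and v: "v \<in> H"
  shows "k \<cdot>\<^sub>v v \<in> H"
proof -
  have v': "v \<in> carrier_vec n"
    using subgroup.mem_carrier[OF H v] by (simp add: monoid_vec_simps)
  have nat: "int i \<cdot>\<^sub>v v \<in> H" for i
  proof (induction i)
    case 0
    have "int 0 \<cdot>\<^sub>v v = 0\<^sub>v n" using v' by auto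
    then show ?case using subgroup.one_closed[OF H] by (simp add: monoid_vec_simps)
  next
    case (Suc i)
    have "int (Suc i) \<cdot>\<^sub>v v = int i \<cdot>\<^sub>v v + v"
      by (rule eq_vecI) (use v' in \<open>auto simp: algebra_simps\<close>)
    then show ?case using subgroup.m_closed[OF H Suc v] by (simp add: monoid_vec_simps)
  qed
  show ?thesis
  proof (cases "k \<ge> 0")
    case True
    then show ?thesis using nat[of "nat k"] by simp
  next
    case False
    have "k \<cdot>\<^sub>v v = - (int (nat (- k)) \<cdot>\<^sub>v v)"
      by (rule eq_vecI) (use False in auto)
    then show ?thesis
      using subgroup.m_inv_closed[OF H nat[of "nat (- k)"]] v' by (simp add: m_inv_monoid_vec)
  qed
qed

lemma generate_cols:
  fixes L :: "int mat"
  assumes L: "L \<in> carrier_mat n m"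
  shows "generate (monoid_vec TYPE(int) n) (set (cols L)) = {L *\<^sub>v z | z. z \<in> carrier_vec m}"
    (is "?G = ?S")
proof
  interpret G: comm_group "monoid_vec TYPE(int) n" by (rule comm_group_vec)
  have cols: "\<exists>j<m. v = col L j" if "v \<in> set (cols L)" for v
    using that L by (auto simp: cols_def)
  show "?G \<subseteq> ?S"
  proof
    fix v assume "v \<in> ?G"
    then show "v \<in> ?S"
    proof induction
      case one
      have "0\<^sub>v n = L *\<^sub>v 0\<^sub>v m" using L by auto
      then show ?case by (auto simp: monoid_vec_simps)
    next
      case (incl v)
      then show ?case using cols mult_mat_vec_unit_vec[OF L]
        by (metis (mono_tags, lifting) mem_Collect_eq unit_vec_carrier)
    next
      case (inv v)
      then obtain j where j: "j < m" "v = col L j" using cols by blast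
      have "inv\<^bsub>monoid_vec TYPE(int) n\<^esub> v = - v"
        using j L by (intro m_inv_monoid_vec) auto
      also have "\<dots> = L *\<^sub>v (- unit_vec m j)"
        by (rule eq_vecI) (use j L in \<open>auto\<close>)
      finally show ?case by auto
    next
      case (eng v w)
      then obtain x y where "v = L *\<^sub>v x" "w = L *\<^sub>v y" "x \<in> carrier_vec m" "y \<in> carrier_vec m"
        by blast
      then have "v \<otimes>\<^bsub>monoid_vec TYPE(int) n\<^esub> w = L *\<^sub>v (x + y)" "x + y \<in> carrier_vec m"
        using L by (auto simp: monoid_vec_simps mult_add_distrib_mat_vec[OF L])
      then show ?case by blast
    qed
  qed
  show "?S \<subseteq> ?G"
  proof clarify
    fix z :: "int vec" assume z: "z \<in> carrier_vec m"
    have sub: "subgroup ?G (monoid_vec TYPE(int) n)"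
      by (rule G.generate_is_subgroup) (use L in \<open>auto simp: monoid_vec_simps cols_def\<close>)
    \<comment> \<open>Truncation of \<open>z\<close> to its first \<open>k\<close> coordinates; each
      induction step adds an integer multiple of one column.\<close>
    let ?z = "\<lambda>k. vec m (\<lambda>j. if j < k then z $ j else 0)"
    have "L *\<^sub>v ?z k \<in> ?G" if "k \<le> m" for k
      using that
    proof (induction k)
      case 0
      have "L *\<^sub>v ?z 0 = 0\<^sub>v n"
        by (rule eq_vecI) (use L in \<open>auto simp: scalar_prod_def\<close>)
      then show ?case using subgroup.one_closed[OF sub] by (simp add: monoid_vec_simps)
    next
      case (Suc k)
      have "?z (Suc k) = ?z k + z $ k \<cdot>\<^sub>v unit_vec m k"
        by (rule eq_vecI) (use Suc.prems in \<open>auto simp: less_Suc_eq\<close>)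
      then have "L *\<^sub>v ?z (Suc k) = L *\<^sub>v ?z k + L *\<^sub>v (z $ k \<cdot>\<^sub>v unit_vec m k)"
        using L by (simp add: mult_add_distrib_mat_vec[OF L])
      also have "L *\<^sub>v (z $ k \<cdot>\<^sub>v unit_vec m k) = z $ k \<cdot>\<^sub>v col L k"
        by (rule eq_vecI) (use L Suc.prems in auto)
      finally have "L *\<^sub>v ?z (Suc k) = L *\<^sub>v ?z k \<otimes>\<^bsub>monoid_vec TYPE(int) n\<^esub> (z $ k \<cdot>\<^sub>v col L k)"
        by (simp add: monoid_vec_simps)
      moreover have "col L k \<in> ?G"
        by (rule generate.incl) (use L Suc.prems in \<open>auto simp: cols_def\<close>)
      ultimately show ?case
        using subgroup.m_closed[OF sub Suc.IH subgroup_monoid_vec_smult_closed[OF sub]] Suc.prems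
        by simp
    qed
    from this[of m] have "L *\<^sub>v ?z m \<in> ?G" by simp
    also have "?z m = z" using z by auto
    finally show "L *\<^sub>v z \<in> ?G" .
  qed
qed

text \<open>The rational span of the lattice is the column space of \<open>L\<close> over the
  rationals. The bound later yields \<open>s - 1 \<le> m\<close>, so that all the \<gamma>'s really
  occur on the diagonal of \<open>smith_diag\<close>.\<close>

lemma lattice_rank_le:
  assumes L: "L \<in> carrier_mat n m"
  shows "lattice_rank n {L *\<^sub>v z | z. z \<in> carrier_vec m} \<le> m"
proof -
  interpret V: vec_space "TYPE(rat)" n .
  let ?L = "map_mat rat_of_int L"
  let ?X = "map_vec rat_of_int ` {L *\<^sub>v z | z. z \<in> carrier_vec m}"
  have L': "?L \<in> carrier_mat n m" using L by simp
  have carr: "set (cols ?L) \<subseteq> carrier_vec n" using L' by (auto simp: cols_def)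
  have X: "?X \<subseteq> carrier_vec n" using L by auto
  have "V.span ?X = V.span (set (cols ?L))"
  proof
    show "V.span ?X \<subseteq> V.span (set (cols ?L))"
    proof (rule V.span_subsetI[OF carr], clarify)
      fix z :: "int vec" assume z: "z \<in> carrier_vec m"
      have "map_vec rat_of_int (L *\<^sub>v z) = ?L *\<^sub>v map_vec rat_of_int z"
        using of_int_hom.mult_mat_vec_hom[OF L z] .
      also have "\<dots> = mat_of_cols n (cols ?L) *\<^sub>v
          vec (length (cols ?L)) (\<lambda>i. map_vec rat_of_int z $ i)"
        using L z mat_of_cols_cols[of ?L] by (intro arg_cong2[of _ _ _ _ "(*\<^sub>v)"]) auto
      also have "\<dots> = V.lincomb_list (\<lambda>i. map_vec rat_of_int z $ i) (cols ?L)"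
        by (rule V.lincomb_list_as_mat_mult[symmetric]) (use carr in auto)
      also have "\<dots> \<in> V.span (set (cols ?L))"
        using V.span_list_as_span[OF carr] unfolding V.span_list_def by blast
      finally show "map_vec rat_of_int (L *\<^sub>v z) \<in> V.span (set (cols ?L))" .
    qed
    have "set (cols ?L) \<subseteq> ?X"
    proof
      fix v assume "v \<in> set (cols ?L)"
      then obtain j where j: "j < m" "v = col ?L j" using L by (auto simp: cols_def)
      have "v = map_vec rat_of_int (L *\<^sub>v unit_vec m j)"
        using j L by (simp add: mult_mat_vec_unit_vec[OF L])
      then show "v \<in> ?X" using unit_vec_carrier[of m j] by blast
    qed
    then show "V.span (set (cols ?L)) \<subseteq> V.span ?X"
      using V.span_is_monotone by blast
  qed
  then have "lattice_rank n {L *\<^sub>v z | z. z \<in> carrier_vec m} = V.rank ?L"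
    by (simp add: lattice_rank_def V.rank_def)
  then show ?thesis using V.rank_le_nc[OF L'] by simp
qed

lemma mult_smith_diag:
  assumes "s - 1 \<le> m" "z \<in> carrier_vec m" "i < s"
  shows "(smith_diag s m \<gamma> *\<^sub>v z) $ i = (if i < s - 1 then int (\<gamma> i) * z $ i else 0)"
proof -
  have "(smith_diag s m \<gamma> *\<^sub>v z) $ i
    = (\<Sum>j<m. (if i = j \<and> i < s - 1 then int (\<gamma> i) else 0) * z $ j)"
    using assms unfolding smith_diag_def
    by (auto simp: scalar_prod_def atLeast0LessThan intro!: sum.cong)
  also have "\<dots> = (\<Sum>j<m. if i = j then if i < s - 1 then int (\<gamma> i) * z $ i else 0 else 0)"
    by (intro sum.cong) auto
  finally show ?thesis using assms by auto
qed

lemma invertible_matE: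
  fixes A :: "'a::semiring_1 mat"
  assumes "invertible_mat A" "A \<in> carrier_mat n n"
  obtains B where "B \<in> carrier_mat n n" "A * B = 1\<^sub>m n" "B * A = 1\<^sub>m n"
proof -
  obtain B where B: "A * B = 1\<^sub>m n" "B * A = 1\<^sub>m (dim_row B)"
    using assms by (auto simp: invertible_mat_def inverts_mat_def)
  then have "B \<in> carrier_mat n n"
    using assms(2) by (metis carrier_matD carrier_matI index_mult_mat(2,3) index_one_mat(2,3))
  then show ?thesis using B that by auto
qed

text \<open>With \<open>D\<close> the diagonal matrix, \<open>a = L z\<close> gives
  \<open>P a = D y\<close> for \<open>y\<close> the inverse of \<open>Q\<close> applied to
  \<open>z\<close>. Conversely, a solution of \<open>P a = D y\<close> gives
  \<open>a = L (Q y)\<close>, because \<open>P\<close> is invertible.\<close>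

lemma mem_smith_lattice_iff:
  fixes L P Q :: "int mat"
  assumes L: "L \<in> carrier_mat s m" and P: "P \<in> carrier_mat s s" "invertible_mat P"
    and Q: "Q \<in> carrier_mat m m" "invertible_mat Q"
    and smith: "P * L * Q = smith_diag s m \<gamma>" and m: "s - 1 \<le> m" and s: "s > 0"
    and pos: "\<And>i. i < s - 1 \<Longrightarrow> \<gamma> i > 0"
  shows "a \<in> {L *\<^sub>v z | z. z \<in> carrier_vec m} \<longleftrightarrow> a \<in> carrier_vec s \<and>
    (\<forall>j<s - 1. int (\<gamma> j) dvd (P *\<^sub>v a) $ j) \<and> (P *\<^sub>v a) $ (s - 1) = 0"
    (is "?l \<longleftrightarrow> ?r")
proof -
  have assoc: "smith_diag s m \<gamma> *\<^sub>v y = P *\<^sub>v (L *\<^sub>v (Q *\<^sub>v y))" if y: "y \<in> carrier_vec m" for y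
    unfolding smith[symmetric] assoc_mult_mat_vec[OF mult_carrier_mat[OF P(1) L] Q(1) y]
    by (rule assoc_mult_mat_vec[OF P(1) L mult_mat_vec_carrier[OF Q(1) y]])
  show ?thesis
  proof
    assume ?l
    then obtain z where z: "z \<in> carrier_vec m" "a = L *\<^sub>v z" by blast
    obtain Q' where Q': "Q' \<in> carrier_mat m m" "Q * Q' = 1\<^sub>m m"
      using invertible_matE[OF Q(2,1)] by metis
    have y: "Q' *\<^sub>v z \<in> carrier_vec m" using Q' z by simp
    have "Q *\<^sub>v (Q' *\<^sub>v z) = z"
      unfolding assoc_mult_mat_vec[OF Q(1) Q'(1) z(1), symmetric] Q'(2)
      by (rule one_mult_mat_vec[OF z(1)])
    then have "P *\<^sub>v a = smith_diag s m \<gamma> *\<^sub>v (Q' *\<^sub>v z)"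
      unfolding assoc[OF y] z(2) by simp
    then show ?r using z L s by (auto simp: mult_smith_diag[OF m y])
  next
    assume r: ?r
    \<comment> \<open>Entries at positions from \<open>s - 1\<close> on are arbitrary: the
      corresponding columns of the diagonal matrix vanish.\<close>
    define y where "y = vec m (\<lambda>j. (P *\<^sub>v a) $ j div int (\<gamma> j))"
    have y: "y \<in> carrier_vec m" by (simp add: y_def)
    have "P *\<^sub>v a = smith_diag s m \<gamma> *\<^sub>v y"
    proof (rule eq_vecI)
      show "dim_vec (P *\<^sub>v a) = dim_vec (smith_diag s m \<gamma> *\<^sub>v y)"
        using P by (simp add: smith_diag_def)
      fix i assume "i < dim_vec (smith_diag s m \<gamma> *\<^sub>v y)"
      then have i: "i < s" by (simp add: smith_diag_def)
      show "(P *\<^sub>v a) $ i = (smith_diag s m \<gamma> *\<^sub>v y) $ i"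
      proof (cases "i < s - 1")
        case True
        then have "int (\<gamma> i) dvd (P *\<^sub>v a) $ i" "y $ i = (P *\<^sub>v a) $ i div int (\<gamma> i)"
          using r m by (auto simp: y_def)
        then show ?thesis using True by (simp only: mult_smith_diag[OF m y i] dvd_mult_div_cancel if_True)
      next
        case False
        then have "i = s - 1" using i by simp
        then show ?thesis using r False mult_smith_diag[OF m y i, of \<gamma>] by simp
      qed
    qed
    also have "\<dots> = P *\<^sub>v (L *\<^sub>v (Q *\<^sub>v y))" by (rule assoc[OF y])
    finally have eq: "P *\<^sub>v a = P *\<^sub>v (L *\<^sub>v (Q *\<^sub>v y))" .
    obtain R where R: "R \<in> carrier_mat s s" "R * P = 1\<^sub>m s"
      using invertible_matE[OF P(2,1)] by metis
    have R_P: "R *\<^sub>v (P *\<^sub>v v) = v" if v: "v \<in> carrier_vec s" for v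
      unfolding assoc_mult_mat_vec[OF R(1) P(1) v, symmetric] R(2) by (rule one_mult_mat_vec[OF v])
    have "L *\<^sub>v (Q *\<^sub>v y) \<in> carrier_vec s" using L Q y by simp
    then have "a = L *\<^sub>v (Q *\<^sub>v y)"
      using arg_cong[OF eq, of "(*\<^sub>v) R"] R_P r by simp
    moreover have "Q *\<^sub>v y \<in> carrier_vec m" using Q y by auto
    ultimately show ?l by blast
  qed
qed

section \<open>Roots of unity\<close>

lemma degree_monom_minus_one:
  assumes "n > 0"
  shows "degree (monom (1::'a::comm_ring_1) n - 1) = n"
proof -
  have "degree (monom (1::'a) n + (- 1)) = degree (monom (1::'a) n)"
    by (rule degree_add_eq_left) (use assms in \<open>simp add: degree_monom_eq\<close>)
  then show ?thesis by (simp add: degree_monom_eq)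
qed

lemma roots_of_unity_altdef: "roots_of_unity n = {z::'a::field. poly (monom 1 n - 1) z = 0}"
  by (simp add: roots_of_unity_def poly_monom)

lemma
  assumes "n > 0"
  shows finite_roots_of_unity: "finite (roots_of_unity n :: 'a::field set)"
    and card_roots_of_unity_le: "card (roots_of_unity n :: 'a set) \<le> n"
proof -
  have "monom (1::'a) n - 1 \<noteq> 0"
    using degree_monom_minus_one[OF assms, where ?'a = 'a] assms by auto
  then show "finite (roots_of_unity n :: 'a set)" "card (roots_of_unity n :: 'a set) \<le> n"
    using poly_roots_finite card_poly_roots_bound degree_monom_minus_one[OF assms]
    unfolding roots_of_unity_altdef by metis+
qed

lemma linear_factors_neq_0: "(\<Prod>z\<leftarrow>zs. [:- z, 1:]) \<noteq> (0::'a::field poly)"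
  by (induction zs) (simp_all del: mult_pCons_left)

lemma degree_linear_factors: "degree (\<Prod>z\<leftarrow>zs. [:- z, 1::'a::field:]) = length zs"
  by (induction zs)
    (simp_all add: degree_mult_eq[OF _ linear_factors_neq_0] del: mult_pCons_left)

lemma poly_linear_factors_eq_0_iff:
  "poly (\<Prod>z\<leftarrow>zs. [:- z, 1::'a::field:]) x = 0 \<longleftrightarrow> x \<in> set zs"
  by (induction zs) (simp_all del: mult_pCons_left)

text \<open>A repeated linear factor would give a root \<open>z\<close> that also annihilates the
  derivative \<open>N z^(N-1)\<close>, impossible since \<open>N\<close> and \<open>z\<close> are
  nonzero in the field.\<close>

lemma card_roots_of_unity_splitting:
  assumes split: "contains_roots_of_unity TYPE('k::field) N" and N: "of_nat N \<noteq> (0::'k)"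
  shows "card (roots_of_unity N :: 'k set) = N"
proof -
  have pos: "N > 0" using N by (cases N) auto
  obtain zs :: "'k list" where "[:0, 1:] ^ N - 1 = (\<Prod>z\<leftarrow>zs. [:- z, 1:])"
    using split unfolding contains_roots_of_unity_def by blast
  then have zs: "monom 1 N - 1 = (\<Prod>z\<leftarrow>zs. [:- z, 1:])" by (simp add: monom_altdef)
  then have len: "length zs = N"
    using degree_linear_factors[of zs] degree_monom_minus_one[OF pos, where ?'a = 'k] by simp
  have roots: "roots_of_unity N = set zs"
    unfolding roots_of_unity_altdef zs poly_linear_factors_eq_0_iff by simp
  have "distinct zs"
  proof (rule ccontr)
    assume "\<not> distinct zs"
    then obtain as bs cs z where decomp: "zs = as @ [z] @ bs @ [z] @ cs"
      using not_distinct_decomp by blast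
    \<comment> \<open>Stated for an abstract \<open>F\<close>, so that the two equal factors are
      moved to the front without the linear polynomials being multiplied out.\<close>
    have prod: "prod_list (map F zs) = F z * (F z * prod_list (map F (as @ bs @ cs)))"
      for F :: "'k \<Rightarrow> 'k poly"
      unfolding decomp by (simp add: mult_ac)
    define q where "q = [:- z, 1:]"
    have q: "poly q z = 0" by (simp add: q_def)
    obtain r where r: "monom 1 N - 1 = q * (q * r)"
      unfolding zs using prod[of "\<lambda>z. [:- z, 1:]"] unfolding q_def[symmetric] by blast
    have "poly (monom 1 N - 1) z = 0" unfolding r by (simp add: q)
    then have "z ^ N = 1" by (simp add: poly_monom)
    then have "z \<noteq> 0" using pos by (auto simp: power_0_left)
    have "poly (pderiv (monom 1 N - 1)) z = 0"
      unfolding r pderiv_mult by (simp add: q)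
    then have "of_nat N * z ^ (N - 1) = 0"
      by (simp add: pderiv_diff pderiv_monom poly_monom)
    then show False using N \<open>z \<noteq> 0\<close> by simp
  qed
  then show ?thesis using roots len distinct_card by metis
qed

text \<open>Root counting in \<open>z^N - 1 = (z^n - 1) h\<close>: the left side has
  \<open>N\<close> roots and \<open>h\<close> has at most \<open>N - n\<close>, leaving at least
  \<open>n\<close> for the other factor.\<close>

lemma card_roots_of_unity:
  assumes split: "contains_roots_of_unity TYPE('k::field) N" and N: "of_nat N \<noteq> (0::'k)"
    and dvd: "n dvd N"
  shows "card (roots_of_unity n :: 'k set) = n"
proof -
  have "N > 0" using N by (cases N) auto
  then have n: "n > 0" using dvd by (auto intro: Nat.gr0I)
  obtain k where k: "N = n * k" using dvd by blast
  \<comment> \<open>The geometric sum in \<open>z^n\<close>, where \<open>N = n * k\<close>.\<close>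
  define h where "h = (\<Sum>i<k. (monom (1::'k) n) ^ i)"
  have fact: "monom (1::'k) N - 1 = (monom 1 n - 1) * h"
    unfolding h_def k power_diff_1_eq[symmetric] by (simp add: monom_power)
  have "monom (1::'k) N - 1 \<noteq> 0"
    using degree_monom_minus_one[OF \<open>N > 0\<close>, where ?'a = 'k] \<open>N > 0\<close> by auto
  then have nz: "monom (1::'k) n - 1 \<noteq> 0" "h \<noteq> 0" using fact by auto
  have deg: "N = n + degree h"
    using arg_cong[OF fact, of degree] degree_mult_eq[OF nz] degree_monom_minus_one n \<open>N > 0\<close>
    by metis
  have "roots_of_unity N = roots_of_unity n \<union> {z::'k. poly h z = 0}"
    unfolding roots_of_unity_altdef fact by auto
  then have "N \<le> card (roots_of_unity n :: 'k set) + card {z::'k. poly h z = 0}"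
    using card_Un_le card_roots_of_unity_splitting[OF split N] by metis
  then have "n \<le> card (roots_of_unity n :: 'k set)"
    using card_poly_roots_bound[OF nz(2)] deg by linarith
  then show ?thesis using card_roots_of_unity_le[OF n] by (metis le_antisym)
qed

text \<open>If \<open>n\<close> does not divide \<open>e\<close>, some root \<open>w\<close> has
  \<open>w powi e \<noteq> 1\<close>. Multiplication by \<open>w\<close> permutes the roots, so the
  sum equals itself times \<open>w powi e\<close> and must vanish.\<close>

lemma sum_roots_of_unity_power_int:
  assumes card: "card (roots_of_unity n :: 'k::field set) = n" and n: "n > 0"
  shows "(\<Sum>z\<in>roots_of_unity n. (z::'k) powi e) = (if int n dvd e then of_nat n else 0)"
proof -
  have nz: "z \<noteq> 0" if "z \<in> roots_of_unity n" for z :: 'k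
    using that n by (auto simp: roots_of_unity_def power_0_left)
  have period: "z powi e = z ^ nat (e mod int n)" if z: "z \<in> roots_of_unity n" for z :: 'k
  proof -
    have "z powi e = z powi (int n * (e div int n) + e mod int n)" by simp
    also have "\<dots> = z powi (e mod int n)"
      unfolding power_int_add[OF disjI1, OF nz[OF z]] power_int_mult
      using z by (simp add: roots_of_unity_def)
    also have "\<dots> = z ^ nat (e mod int n)" using n by (simp add: power_int_def)
    finally show ?thesis .
  qed
  show ?thesis
  proof (cases "int n dvd e")
    case True
    then show ?thesis using card by (simp add: period dvd_imp_mod_0)
  next
    case False
    define r where "r = nat (e mod int n)"
    have "e mod int n \<noteq> 0" using False by (simp only: dvd_eq_mod_eq_0 not_False_eq_True)
    moreover have "0 \<le> e mod int n" "e mod int n < int n" using n by simp_all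
    ultimately have r: "0 < r" "r < n" unfolding r_def by linarith+
    \<comment> \<open>By counting: there are \<open>n\<close> roots of order dividing
      \<open>n\<close>, but at most \<open>r < n\<close> solutions of
      \<open>z^r = 1\<close>.\<close>
    have "\<not> roots_of_unity n \<subseteq> (roots_of_unity r :: 'k set)"
    proof
      assume "roots_of_unity n \<subseteq> (roots_of_unity r :: 'k set)"
      from card_mono[OF finite_roots_of_unity[OF r(1)] this] show False
        using card card_roots_of_unity_le[OF r(1), where ?'a = 'k] r(2) by simp
    qed
    then obtain w :: 'k where "w \<in> roots_of_unity n" "w \<notin> roots_of_unity r" by blast
    then have w: "w \<in> roots_of_unity n" "w ^ r \<noteq> 1" by (simp_all add: roots_of_unity_def)
    have "(\<Sum>z\<in>roots_of_unity n. z powi e) = (\<Sum>z\<in>roots_of_unity n. (w * z) powi e)"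
      by (rule sum.reindex_bij_witness[of _ "\<lambda>z. w * z" "\<lambda>z. z / w"])
        (use w(1) nz[OF w(1)] in \<open>simp_all add: roots_of_unity_def power_mult_distrib power_divide\<close>)
    also have "\<dots> = w ^ r * (\<Sum>z\<in>roots_of_unity n. z powi e)"
      by (simp add: power_int_mult_distrib sum_distrib_left period[OF w(1)] r_def)
    finally have "(w ^ r - 1) * (\<Sum>z\<in>roots_of_unity n. z powi e) = 0" by (simp add: algebra_simps)
    then show ?thesis using w(2) False by simp
  qed
qed

section \<open>Exponent vectors and binomials\<close>

text \<open>Exponents as integer vectors, so that they can be subtracted and multiplied by
  \<open>P\<close>. Coordinates from \<open>s\<close> on are dropped, so faithfulness requires keys
  below \<open>s\<close>.\<close>

definition exponent_vec :: "nat \<Rightarrow> (nat \<Rightarrow>\<^sub>0 nat) \<Rightarrow> int vec" where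
  "exponent_vec s c = vec s (\<lambda>i. int (Poly_Mapping.lookup c i))"

lemma exponent_vec_carrier [simp]: "exponent_vec s c \<in> carrier_vec s"
  by (simp add: exponent_vec_def)

lemma lookup_pos_part:
  "Poly_Mapping.lookup (pos_part a) i = (if i < dim_vec a then nat (a $ i) else 0)"
  by (simp add: pos_part_def lookup_sum lookup_single when_def)

lemma keys_pos_part: "Poly_Mapping.keys (pos_part a) \<subseteq> {..<dim_vec a}"
  by (auto simp: in_keys_iff lookup_pos_part split: if_splits)

lemma exponent_vec_pos_part:
  assumes "a \<in> carrier_vec s"
  shows "exponent_vec s (pos_part a) = a + exponent_vec s (pos_part (- a))"
  by (rule eq_vecI) (use assms in \<open>auto simp: exponent_vec_def lookup_pos_part\<close>)

lemma weighted_degree_superset: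
  assumes "Poly_Mapping.keys c \<subseteq> {..<s}"
  shows "weighted_degree d c = (\<Sum>i<s. d i * Poly_Mapping.lookup c i)"
  unfolding weighted_degree_def
  by (rule sum.mono_neutral_left) (use assms in \<open>auto simp: in_keys_iff\<close>)

lemma int_weighted_degree:
  assumes "Poly_Mapping.keys c \<subseteq> {..<s}"
  shows "int (weighted_degree d c) = vec s (\<lambda>i. int (d i)) \<bullet> exponent_vec s c"
  by (simp add: weighted_degree_superset[OF assms] scalar_prod_def exponent_vec_def
      atLeast0LessThan)

lemma ideal_mpoly_ringD:
  assumes "ideal I (mpoly_ring s)"
  shows "0 \<in> I" and "f \<in> I \<Longrightarrow> g \<in> I \<Longrightarrow> f + g \<in> I"
    and "h \<in> carrier (mpoly_ring s) \<Longrightarrow> f \<in> I \<Longrightarrow> h * f \<in> I"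
proof -
  interpret ideal I "mpoly_ring s" by fact
  show "0 \<in> I" using additive_subgroup.zero_closed[OF is_additive_subgroup] by (simp add: mpoly_ring_def)
  show "f + g \<in> I" if "f \<in> I" "g \<in> I" using additive_subgroup.a_closed[OF is_additive_subgroup that] by (simp add: mpoly_ring_def)
  show "h * f \<in> I" if "h \<in> carrier (mpoly_ring s)" "f \<in> I"
    using I_l_closed[OF that(2,1)] by (simp add: mpoly_ring_def)
qed

lemma ideal_mpoly_ring_sum:
  assumes "ideal I (mpoly_ring s)" "\<And>x. x \<in> A \<Longrightarrow> f x \<in> I"
  shows "(\<Sum>x\<in>A. f x) \<in> I"
  using assms(2)
  by (induction A rule: infinite_finite_induct)
    (simp_all add: ideal_mpoly_ringD[OF assms(1)])

section \<open>Membership in the binomial ideal of a lattice\<close>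

lemma lattice_generators_carrier:
  assumes "\<L> \<subseteq> carrier_vec s"
  shows "{monomial (pos_part a) - monomial (pos_part (- a)) | a. a \<in> \<L>}
    \<subseteq> carrier (mpoly_ring s :: 'k::field mpoly ring)"
proof clarify
  fix a assume "a \<in> \<L>"
  then have "dim_vec a = s" using assms by auto
  then have "Poly_Mapping.keys (pos_part a) \<subseteq> {..<s}" "Poly_Mapping.keys (pos_part (- a)) \<subseteq> {..<s}"
    using keys_pos_part[of a] keys_pos_part[of "- a"] by auto
  then show "monomial (pos_part a) - monomial (pos_part (- a))
      \<in> carrier (mpoly_ring s :: 'k mpoly ring)"
    unfolding mem_carrier_mpoly_ring monomial_def
    using keys_diff[of "Poly_Mapping.single (pos_part a) (1::'k)" "Poly_Mapping.single (pos_part (- a)) 1"]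
    by fastforce
qed

lemma ideal_lattice_ideal:
  assumes "\<L> \<subseteq> carrier_vec s"
  shows "ideal (lattice_ideal s \<L> :: 'k::field mpoly set) (mpoly_ring s)"
  unfolding lattice_ideal_def
  by (rule ring.genideal_ideal[OF cring.axioms(1)[OF mpoly_ring_cring]
        lattice_generators_carrier[OF assms]])

text \<open>Dividing out the greatest common monomial divisor of the two terms leaves the generator
  attached to the difference of the exponents.\<close>

lemma binomial_in_lattice_ideal:
  assumes \<L>: "\<L> \<subseteq> carrier_vec s"
    and a: "Poly_Mapping.keys a \<subseteq> {..<s}" and b: "Poly_Mapping.keys b \<subseteq> {..<s}"
    and diff: "exponent_vec s a - exponent_vec s b \<in> \<L>"
  shows "monomial a - monomial b \<in> (lattice_ideal s \<L> :: 'k::field mpoly set)"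
proof -
  define v where "v = exponent_vec s a - exponent_vec s b"
  \<comment> \<open>The componentwise minimum of \<open>a\<close> and \<open>b\<close>; the
    truncated subtraction loses nothing because \<open>pos_part v\<close> is bounded by
    \<open>a\<close>.\<close>
  define c where "c = a - pos_part v"
  have out: "Poly_Mapping.lookup a i = 0" "Poly_Mapping.lookup b i = 0" if "\<not> i < s" for i
    using that a b by (auto simp: in_keys_iff subset_iff)
  have "a = c + pos_part v"
    by (rule poly_mapping_eqI)
      (use out in \<open>auto simp: c_def v_def lookup_add lookup_minus lookup_pos_part exponent_vec_def\<close>)
  moreover have "b = c + pos_part (- v)"
    by (rule poly_mapping_eqI)
      (use out in \<open>auto simp: c_def v_def lookup_add lookup_minus lookup_pos_part exponent_vec_def\<close>)
  ultimately have eq: "monomial a - monomial b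
      = (monomial c :: 'k mpoly) * (monomial (pos_part v) - monomial (pos_part (- v)))"
    by (simp add: monomial_def right_diff_distrib mult_single)
  have "Poly_Mapping.keys c \<subseteq> {..<s}"
    using out(1) unfolding c_def by (auto simp: in_keys_iff lookup_minus intro: ccontr)
  then have "(monomial c :: 'k mpoly) \<in> carrier (mpoly_ring s)" by (simp add: monomial_in_carrier_iff)
  moreover have "monomial (pos_part v) - monomial (pos_part (- v)) \<in> (lattice_ideal s \<L> :: 'k mpoly set)"
    using ring.genideal_self[OF cring.axioms(1)[OF mpoly_ring_cring] lattice_generators_carrier[OF \<L>]]
      diff unfolding lattice_ideal_def v_def by blast
  ultimately show ?thesis
    unfolding eq by (rule ideal_mpoly_ringD(3)[OF ideal_lattice_ideal[OF \<L>]])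
qed

lemma subgroup_monoid_vecD:
  fixes H :: "int vec set"
  assumes H: "subgroup H (monoid_vec TYPE(int) s)"
  shows "H \<subseteq> carrier_vec s" "0\<^sub>v s \<in> H" "v \<in> H \<Longrightarrow> - v \<in> H" "v \<in> H \<Longrightarrow> w \<in> H \<Longrightarrow> v + w \<in> H"
proof -
  show sub: "H \<subseteq> carrier_vec s" using subgroup.subset[OF H] by (simp add: monoid_vec_simps)
  show "0\<^sub>v s \<in> H" using subgroup.one_closed[OF H] by (simp add: monoid_vec_simps)
  show "- v \<in> H" if "v \<in> H"
    using subgroup.m_inv_closed[OF H that] sub that by (metis m_inv_monoid_vec subsetD)
  show "v + w \<in> H" if "v \<in> H" "w \<in> H"
    using subgroup.m_closed[OF H that] by (simp add: monoid_vec_simps)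
qed

text \<open>
  Modulo the lattice ideal every monomial can be replaced by a fixed representative of its class;
  afterwards \<open>f\<close> has the class sums as its coefficients.
\<close>

lemma in_lattice_ideal_if_class_sums_zero:
  fixes f :: "'k::field mpoly"
  assumes \<L>: "subgroup \<L> (monoid_vec TYPE(int) s)" and f: "f \<in> carrier (mpoly_ring s)"
    and zero: "\<And>b. b \<in> Poly_Mapping.keys f \<Longrightarrow>
      (\<Sum>c \<in> {c \<in> Poly_Mapping.keys f. exponent_vec s c - exponent_vec s b \<in> \<L>}.
        Poly_Mapping.lookup f c) = 0"
  shows "f \<in> lattice_ideal s \<L>"
proof -
  let ?K = "Poly_Mapping.keys f" and ?e = "exponent_vec s"
  define r where "r c = (SOME b. b \<in> ?K \<and> ?e c - ?e b \<in> \<L>)" for c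
  note sub = subgroup_monoid_vecD[OF \<L>]
  have r: "r c \<in> ?K" "?e c - ?e (r c) \<in> \<L>" if "c \<in> ?K" for c
  proof -
    have "?e c - ?e c = 0\<^sub>v s" by auto
    then have "c \<in> ?K \<and> ?e c - ?e c \<in> \<L>" using sub(2) that by metis
    from someI[of "\<lambda>b. b \<in> ?K \<and> ?e c - ?e b \<in> \<L>", OF this]
    show "r c \<in> ?K" "?e c - ?e (r c) \<in> \<L>" unfolding r_def by blast+
  qed
  \<comment> \<open>Congruent exponents yield equivalent predicates under \<open>SOME\<close>, hence
    the same representative.\<close>
  have r_eq: "r c = r b" if "?e c - ?e b \<in> \<L>" for b c
  proof -
    have "?e c - ?e x \<in> \<L> \<longleftrightarrow> ?e b - ?e x \<in> \<L>" for x
    proof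
      have "?e b - ?e x = - (?e c - ?e b) + (?e c - ?e x)"
        by (rule eq_vecI) (auto simp: exponent_vec_def)
      then show "?e b - ?e x \<in> \<L>" if "?e c - ?e x \<in> \<L>"
        using sub(3,4) that \<open>?e c - ?e b \<in> \<L>\<close> by metis
      have "?e c - ?e x = (?e c - ?e b) + (?e b - ?e x)"
        by (rule eq_vecI) (auto simp: exponent_vec_def)
      then show "?e c - ?e x \<in> \<L>" if "?e b - ?e x \<in> \<L>"
        using sub(4) that \<open>?e c - ?e b \<in> \<L>\<close> by metis
    qed
    then show ?thesis unfolding r_def by simp
  qed
  let ?g = "\<lambda>c. Poly_Mapping.single (r c) (Poly_Mapping.lookup f c)"
  have "(\<Sum>c\<in>?K. ?g c) = (\<Sum>b\<in>r ` ?K. \<Sum>c\<in>{c \<in> ?K. r c = b}. ?g c)"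
    by (rule sum.image_gen) simp
  also have "\<dots> = (\<Sum>b\<in>r ` ?K. 0)"
  proof (rule sum.cong)
    fix b assume "b \<in> r ` ?K"
    then obtain x where "x \<in> ?K" "b = r x" by blast
    then have b: "b \<in> ?K" "r b = b" using r[of x] r_eq[of x "r x"] by simp_all
    have "{c \<in> ?K. r c = b} = {c \<in> ?K. ?e c - ?e b \<in> \<L>}"
      using r r_eq b by (auto; metis)
    then have "(\<Sum>c\<in>{c \<in> ?K. r c = b}. Poly_Mapping.lookup f c) = 0" using zero[OF b(1)] by simp
    moreover have "(\<Sum>c\<in>{c \<in> ?K. r c = b}. ?g c)
        = Poly_Mapping.single b (\<Sum>c\<in>{c \<in> ?K. r c = b}. Poly_Mapping.lookup f c)"
      by (rule poly_mapping_eqI) (auto simp: lookup_sum lookup_single when_def intro!: sum.cong)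
    ultimately show "(\<Sum>c\<in>{c \<in> ?K. r c = b}. ?g c) = 0" by simp
  qed simp
  finally have sum_zero: "(\<Sum>c\<in>?K. ?g c) = 0" by simp
  \<comment> \<open>The polynomial with all exponents replaced by representatives is zero, so
    subtracting it writes \<open>f\<close> as a combination of binomials; \<open>single 0 k\<close>
    below is the constant \<open>k\<close>.\<close>
  have "f = (\<Sum>c\<in>?K. Poly_Mapping.single c (Poly_Mapping.lookup f c) - ?g c)"
    unfolding sum_subtractf sum_zero by (simp add: poly_mapping_sum_single)
  also have "\<dots> = (\<Sum>c\<in>?K. Poly_Mapping.single 0 (Poly_Mapping.lookup f c)
      * (monomial c - monomial (r c)))"
    by (simp add: monomial_def right_diff_distrib mult_single)
  also have "\<dots> \<in> lattice_ideal s \<L>"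
  proof (rule ideal_mpoly_ring_sum[OF ideal_lattice_ideal[OF sub(1)]])
    fix c assume c: "c \<in> ?K"
    have "Poly_Mapping.keys c \<subseteq> {..<s}" "Poly_Mapping.keys (r c) \<subseteq> {..<s}"
      using f c r(1)[OF c] unfolding mem_carrier_mpoly_ring by blast+
    then have "monomial c - monomial (r c) \<in> (lattice_ideal s \<L> :: 'k mpoly set)"
      by (rule binomial_in_lattice_ideal[OF sub(1)]) (rule r(2)[OF c])
    then show "Poly_Mapping.single 0 (Poly_Mapping.lookup f c) * (monomial c - monomial (r c))
        \<in> lattice_ideal s \<L>"
      by (intro ideal_mpoly_ringD(3)[OF ideal_lattice_ideal[OF sub(1)]])
        (simp_all add: mem_carrier_mpoly_ring)
  qed
  finally show ?thesis .
qed

text \<open>If the two terms of a generator had different degrees, homogeneity would put a monomial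
  into the ideal. But every generator vanishes when all variables are set to 1, and a monomial does
  not.\<close>

lemma graded_lattice_ideal_orthogonal:
  assumes \<L>: "\<L> \<subseteq> carrier_vec s"
    and graded: "graded_ideal s d (lattice_ideal s \<L> :: 'k::field mpoly set)"
    and a: "a \<in> \<L>"
  shows "vec s (\<lambda>i. int (d i)) \<bullet> a = 0"
proof -
  let ?p = "pos_part a" and ?n = "pos_part (- a)"
  have "weighted_degree d ?p = weighted_degree d ?n"
  proof (rule ccontr)
    assume neq: "weighted_degree d ?p \<noteq> weighted_degree d ?n"
    \<comment> \<open>The kernel of evaluation of all variables at 1.\<close>
    let ?N = "a_kernel (mpoly_ring s) class_ring (mpoly_subst (\<lambda>_. 1) :: 'k mpoly \<Rightarrow> _)"
    interpret R: cring "mpoly_ring s :: 'k mpoly ring" by (rule mpoly_ring_cring)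
    have one: "mpoly_subst (\<lambda>_. 1) (monomial c :: 'k mpoly) = 1" for c
      by (simp add: monomial_def mpoly_subst_single subst_monomial_def)
    have "lattice_ideal s \<L> \<subseteq> ?N"
      unfolding lattice_ideal_def
    proof (rule R.genideal_minimal)
      show "ideal ?N (mpoly_ring s)"
        by (rule primeideal.axioms(1)
            [OF ring_hom_cring.primeideal_a_kernel[OF ring_hom_cring_mpoly_subst domain_class_ring]])
      show "{monomial (pos_part a) - monomial (pos_part (- a)) |a. a \<in> \<L>} \<subseteq> ?N"
        using lattice_generators_carrier[OF \<L>, where ?'k = 'k]
        unfolding mem_a_kernel_mpoly_ring subset_iff by (auto simp: mpoly_subst_diff one)
    qed
    moreover have "homogeneous_part d (weighted_degree d ?p) (monomial ?p - monomial ?n :: 'k mpoly)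
        = monomial ?p"
    proof -
      have "?p \<noteq> ?n" using neq by metis
      then have keys: "Poly_Mapping.keys (monomial ?p - monomial ?n :: 'k mpoly) = {?p, ?n}"
        by (auto simp: in_keys_iff monomial_def lookup_minus lookup_single when_def split: if_splits)
      have "{c \<in> {?p, ?n}. weighted_degree d c = weighted_degree d ?p} = {?p}"
        using neq by auto
      then show ?thesis
        unfolding homogeneous_part_def keys using \<open>?p \<noteq> ?n\<close>
        by (simp add: monomial_def lookup_minus lookup_single when_def)
    qed
    moreover have "monomial ?p - monomial ?n \<in> (lattice_ideal s \<L> :: 'k mpoly set)"
      using R.genideal_self[OF lattice_generators_carrier[OF \<L>]] a
      unfolding lattice_ideal_def by blast
    ultimately have "monomial ?p \<in> ?N"
      using graded unfolding graded_ideal_def by (metis subsetD)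
    then show False by (simp add: mem_a_kernel_mpoly_ring one)
  qed
  moreover have a': "a \<in> carrier_vec s" using \<L> a by blast
  moreover from this have keys: "Poly_Mapping.keys ?p \<subseteq> {..<s}" "Poly_Mapping.keys ?n \<subseteq> {..<s}"
    using keys_pos_part[of a] keys_pos_part[of "- a"] by auto
  have "int (weighted_degree d ?p) = vec s (\<lambda>i. int (d i)) \<bullet> a + int (weighted_degree d ?n)"
    unfolding int_weighted_degree[OF keys(1)] int_weighted_degree[OF keys(2)]
      exponent_vec_pos_part[OF a']
    by (rule scalar_prod_add_distrib[OF vec_carrier a' exponent_vec_carrier])
  ultimately show ?thesis by simp
qed

section \<open>Characters of the lattice\<close>

text \<open>On an exponent vector this is the coefficient of the image of the monomial under
  \<open>param_hom\<close>. It takes arbitrary integer vectors because differences of exponents are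
  needed.\<close>

definition torus_char :: "nat \<Rightarrow> int mat \<Rightarrow> (nat \<Rightarrow> 'k::field) \<Rightarrow> int vec \<Rightarrow> 'k" where
  "torus_char s P \<zeta> v = (\<Prod>j<s - 1. \<zeta> j powi ((P *\<^sub>v v) $ j))"

lemma torus_char_add:
  assumes "P \<in> carrier_mat s s" "v \<in> carrier_vec s" "w \<in> carrier_vec s"
    and "\<And>j. j < s - 1 \<Longrightarrow> \<zeta> j \<noteq> 0"
  shows "torus_char s P \<zeta> (v + w) = torus_char s P \<zeta> v * torus_char s P \<zeta> w"
  unfolding torus_char_def mult_add_distrib_mat_vec[OF assms(1-3)] prod.distrib[symmetric]
  by (rule prod.cong) (use assms in \<open>auto simp: power_int_add scalar_prod_add_distrib[of _ s]\<close>)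

lemma torus_char_neq_0:
  assumes "\<And>j. j < s - 1 \<Longrightarrow> \<zeta> j \<noteq> 0"
  shows "torus_char s P \<zeta> v \<noteq> 0"
  using assms by (simp add: torus_char_def)

section \<open>Evaluation of the parametrizations on monomials\<close>

lemma prod_monom: "(\<Prod>i\<in>A. monom (f i) (g i)) = monom (\<Prod>i\<in>A. f i) (\<Sum>i\<in>A. g i)"
  by (induction A rule: infinite_finite_induct) (simp_all add: mult_monom)

lemma power_int_sum:
  assumes "(x :: 'a::field) \<noteq> 0"
  shows "x powi (\<Sum>i\<in>A. f i) = (\<Prod>i\<in>A. x powi f i)"
  using assms by (induction A rule: infinite_finite_induct) (simp_all add: power_int_add)

text \<open>Interchanging the products over variables and over roots collects the exponent of each
  \<open>\<zeta> j\<close> into row \<open>j\<close> of \<open>P\<close> times the exponent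
  vector.\<close>

lemma subst_monomial_torus_char:
  assumes P: "P \<in> carrier_mat s s" and nz: "\<And>j. j < s - 1 \<Longrightarrow> \<zeta> j \<noteq> 0"
    and c: "Poly_Mapping.keys c \<subseteq> {..<s}"
  shows "subst_monomial
      (\<lambda>i. Polynomial.smult (\<Prod>j<s - 1. \<zeta> j powi (P $$ (j, i))) ([:0, 1:] ^ d i)) c
    = monom (torus_char s P \<zeta> (exponent_vec s c)) (weighted_degree d c)"
proof -
  let ?w = "\<lambda>i. \<Prod>j<s - 1. \<zeta> j powi (P $$ (j, i))" and ?c = "Poly_Mapping.lookup c"
  have "(\<Prod>i<s. ?w i ^ ?c i) = (\<Prod>i<s. \<Prod>j<s - 1. \<zeta> j powi (P $$ (j, i) * int (?c i)))"
    by (simp add: prod_power_distrib power_int_mult)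
  also have "\<dots> = (\<Prod>j<s - 1. \<Prod>i<s. \<zeta> j powi (P $$ (j, i) * int (?c i)))"
    by (rule prod.swap)
  also have "\<dots> = torus_char s P \<zeta> (exponent_vec s c)"
    unfolding torus_char_def
  proof (rule prod.cong)
    fix j assume "j \<in> {..<s - 1}"
    then have j: "j < s - 1" by simp
    have "(P *\<^sub>v exponent_vec s c) $ j = (\<Sum>i<s. P $$ (j, i) * int (?c i))"
      using P j by (simp add: scalar_prod_def exponent_vec_def atLeast0LessThan)
    then show "(\<Prod>i<s. \<zeta> j powi (P $$ (j, i) * int (?c i)))
        = \<zeta> j powi ((P *\<^sub>v exponent_vec s c) $ j)"
      by (simp add: power_int_sum[OF nz[OF j]])
  qed simp
  finally have char: "(\<Prod>i<s. ?w i ^ ?c i) = torus_char s P \<zeta> (exponent_vec s c)" .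
  have "subst_monomial (\<lambda>i. Polynomial.smult (?w i) ([:0, 1:] ^ d i)) c
      = (\<Prod>i<s. monom (?w i ^ ?c i) (d i * ?c i))"
    unfolding subst_monomial_superset[OF finite_lessThan c]
    by (simp add: monom_altdef[symmetric] monom_power)
  then show ?thesis
    by (simp only: prod_monom char weighted_degree_superset[OF c])
qed

lemma param_hom_diff: "param_hom s P d \<zeta> (f - g) = param_hom s P d \<zeta> f - param_hom s P d \<zeta> g"
  by (simp add: param_hom_def mpoly_subst_diff)

lemma param_hom_single:
  assumes "P \<in> carrier_mat s s" "\<And>j. j < s - 1 \<Longrightarrow> \<zeta> j \<noteq> 0" "Poly_Mapping.keys c \<subseteq> {..<s}"
  shows "param_hom s P d \<zeta> (Poly_Mapping.single c k)
    = monom (k * torus_char s P \<zeta> (exponent_vec s c)) (weighted_degree d c)"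
  using subst_monomial_torus_char[OF assms]
  by (simp add: param_hom_def mpoly_subst_single smult_monom)

text \<open>Monomials map to monomials, so only terms of weighted degree \<open>n\<close> contribute
  to the coefficient of \<open>x^n\<close>.\<close>

lemma coeff_param_hom:
  assumes P: "P \<in> carrier_mat s s" and nz: "\<And>j. j < s - 1 \<Longrightarrow> \<zeta> j \<noteq> 0"
    and f: "f \<in> carrier (mpoly_ring s)"
  shows "poly.coeff (param_hom s P d \<zeta> f) n
    = (\<Sum>c\<in>{c \<in> Poly_Mapping.keys f. weighted_degree d c = n}.
        Poly_Mapping.lookup f c * torus_char s P \<zeta> (exponent_vec s c))"
proof -
  have "param_hom s P d \<zeta> f
    = (\<Sum>c\<in>Poly_Mapping.keys f. param_hom s P d \<zeta> (Poly_Mapping.single c (Poly_Mapping.lookup f c)))"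
    unfolding param_hom_def mpoly_subst_sum[symmetric] poly_mapping_sum_single ..
  also have "\<dots> = (\<Sum>c\<in>Poly_Mapping.keys f.
      monom (Poly_Mapping.lookup f c * torus_char s P \<zeta> (exponent_vec s c)) (weighted_degree d c))"
    using f by (intro sum.cong refl param_hom_single[OF P nz]) (auto simp: mem_carrier_mpoly_ring)
  finally show ?thesis
    by (simp add: coeff_sum sum.inter_filter)
qed

lemma root_tuplesD:
  assumes "\<zeta> \<in> root_tuples s \<gamma>" "j < s - 1"
  shows "\<zeta> j ^ \<gamma> j = 1" and "\<gamma> j > 0 \<Longrightarrow> \<zeta> j \<noteq> 0"
proof -
  show one: "\<zeta> j ^ \<gamma> j = 1"
    using assms by (auto simp: root_tuples_def roots_of_unity_def PiE_iff)
  show "\<zeta> j \<noteq> 0" if "\<gamma> j > 0"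
    using one that by (auto simp: power_0_left)
qed

text \<open>Orthogonality for the product group: by distributivity the sum factors into power sums
  of roots of unity, one for each index.\<close>

lemma sum_torus_char:
  assumes card: "\<And>j. j < s - 1 \<Longrightarrow> card (roots_of_unity (\<gamma> j) :: 'k::field set) = \<gamma> j"
    and pos: "\<And>j. j < s - 1 \<Longrightarrow> \<gamma> j > 0"
  shows "(\<Sum>\<zeta>\<in>root_tuples s \<gamma>. torus_char s P \<zeta> v :: 'k)
    = (if \<forall>j<s - 1. int (\<gamma> j) dvd (P *\<^sub>v v) $ j then of_nat (\<Prod>j<s - 1. \<gamma> j) else 0)"
proof -
  have "(\<Sum>\<zeta>\<in>root_tuples s \<gamma>. torus_char s P \<zeta> v :: 'k)
    = (\<Prod>j<s - 1. \<Sum>z\<in>roots_of_unity (\<gamma> j). z powi ((P *\<^sub>v v) $ j))"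
    unfolding root_tuples_def torus_char_def
    by (rule prod_sum_PiE[symmetric]) (simp_all add: finite_roots_of_unity pos)
  also have "\<dots> = (\<Prod>j<s - 1. if int (\<gamma> j) dvd (P *\<^sub>v v) $ j then of_nat (\<gamma> j) else 0)"
    by (intro prod.cong refl sum_roots_of_unity_power_int card pos) simp_all
  also have "\<dots> = (if \<forall>j<s - 1. int (\<gamma> j) dvd (P *\<^sub>v v) $ j then of_nat (\<Prod>j<s - 1. \<gamma> j) else 0)"
  proof (cases "\<forall>j<s - 1. int (\<gamma> j) dvd (P *\<^sub>v v) $ j")
    case True
    then show ?thesis by simp
  next
    case False
    then obtain j where "j \<in> {..<s - 1}" "\<not> int (\<gamma> j) dvd (P *\<^sub>v v) $ j" by auto
    then show ?thesis using False by (simp only: if_False, intro prod_zero) auto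
  qed
  finally show ?thesis .
qed

section \<open>The primes of a graded lattice ideal\<close>

text \<open>The data left once \<open>L\<close> and \<open>Q\<close> are eliminated:
  \<open>mem_iff\<close> carries the Smith normal form and \<open>orthogonal\<close> carries the
  grading. The field enters only in the individual lemmas.\<close>

locale graded_lattice =
  fixes s :: nat and \<L> :: "int vec set" and P :: "int mat" and \<gamma> d :: "nat \<Rightarrow> nat"
  assumes s_pos: "s > 0"
    and subgroup: "subgroup \<L> (monoid_vec TYPE(int) s)"
    and P: "P \<in> carrier_mat s s" "invertible_mat P"
    and pos: "\<And>j. j < s - 1 \<Longrightarrow> \<gamma> j > 0"
    and mem_iff: "\<And>a. a \<in> \<L> \<longleftrightarrow> a \<in> carrier_vec s \<and>
      (\<forall>j<s - 1. int (\<gamma> j) dvd (P *\<^sub>v a) $ j) \<and> (P *\<^sub>v a) $ (s - 1) = 0"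
    and d_pos: "\<And>i. i < s \<Longrightarrow> d i > 0"
    and orthogonal: "\<And>a. a \<in> \<L> \<Longrightarrow> vec s (\<lambda>i. int (d i)) \<bullet> a = 0"
begin

abbreviation \<delta> :: "int vec" where "\<delta> \<equiv> vec s (\<lambda>i. int (d i))"

text \<open>\<open>R\<close> is the inverse of \<open>P\<close>. For \<open>j < s - 1\<close> the
  multiple of \<open>col R j\<close> by \<open>\<gamma> j\<close> lies in the lattice, so \<delta>
  annihilates it and, as \<open>\<gamma> j > 0\<close>, annihilates the column itself.\<close>

lemma dual_basis:
  obtains R where "R \<in> carrier_mat s s" "\<And>v. v \<in> carrier_vec s \<Longrightarrow> R *\<^sub>v (P *\<^sub>v v) = v"
    "\<And>j. j < s \<Longrightarrow> P *\<^sub>v col R j = unit_vec s j"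
    "\<And>j. j < s - 1 \<Longrightarrow> \<delta> \<bullet> col R j = 0"
proof -
  obtain R where R: "R \<in> carrier_mat s s" "P * R = 1\<^sub>m s" "R * P = 1\<^sub>m s"
    using invertible_matE[OF P(2,1)] by metis
  have R_P: "R *\<^sub>v (P *\<^sub>v v) = v" if v: "v \<in> carrier_vec s" for v
    unfolding assoc_mult_mat_vec[OF R(1) P(1) v, symmetric] R(3) by (rule one_mult_mat_vec[OF v])
  have P_col: "P *\<^sub>v col R j = unit_vec s j" if j: "j < s" for j
    using col_mult2[OF P(1) R(1) j] j unfolding R(2) by simp
  have "\<delta> \<bullet> col R j = 0" if j: "j < s - 1" for j
  proof -
    have "P *\<^sub>v (int (\<gamma> j) \<cdot>\<^sub>v col R j) = int (\<gamma> j) \<cdot>\<^sub>v unit_vec s j"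
      unfolding P_col[of j, symmetric, OF less_le_trans[OF j diff_le_self]]
      by (rule eq_vecI) (use P(1) R(1) in auto)
    then have "int (\<gamma> j) \<cdot>\<^sub>v col R j \<in> \<L>"
      unfolding mem_iff using j R(1) by auto
    from orthogonal[OF this] have "int (\<gamma> j) * (\<delta> \<bullet> col R j) = 0"
      using R(1) by (simp add: scalar_prod_smult_distrib[of _ s])
    then show ?thesis using pos[OF j] by simp
  qed
  then show ?thesis using R(1) R_P P_col that by blast
qed

text \<open>
  The linear form \<open>\<delta>\<close> vanishes on the first \<open>s - 1\<close> vectors of the basis dual to the rows of \<open>P\<close>,
  so it is a nonzero multiple of the last row of \<open>P\<close>.
\<close>

lemma mem_iff_orthogonal:
  assumes v: "v \<in> carrier_vec s" and "\<delta> \<bullet> v = 0"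
  shows "v \<in> \<L> \<longleftrightarrow> (\<forall>j<s - 1. int (\<gamma> j) dvd (P *\<^sub>v v) $ j)"
proof -
  obtain R where R: "R \<in> carrier_mat s s" "\<And>v. v \<in> carrier_vec s \<Longrightarrow> R *\<^sub>v (P *\<^sub>v v) = v"
    "\<And>j. j < s - 1 \<Longrightarrow> \<delta> \<bullet> col R j = 0"
    by (rule dual_basis) blast
  \<comment> \<open>Expand \<open>w = R (P w)\<close> in the columns of \<open>R\<close>; \<delta>
    kills all of them except possibly the last.\<close>
  have form: "\<delta> \<bullet> w = (\<delta> \<bullet> col R (s - 1)) * (P *\<^sub>v w) $ (s - 1)" if w: "w \<in> carrier_vec s" for w
  proof -
    have Pw: "P *\<^sub>v w \<in> carrier_vec s" using P(1) w by simp
    have "\<delta> \<bullet> w = (transpose_mat R *\<^sub>v \<delta>) \<bullet> (P *\<^sub>v w)"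
      using transpose_vec_mult_scalar[OF R(1) Pw, of \<delta>] R(2)[OF w] by simp
    also have "\<dots> = (\<Sum>j<s. (\<delta> \<bullet> col R j) * (P *\<^sub>v w) $ j)"
      unfolding scalar_prod_def[of _ "P *\<^sub>v w"] atLeast0LessThan
      using R(1) P(1) by (intro sum.cong) (auto simp: comm_scalar_prod[of _ s])
    also have "\<dots> = (\<Sum>j\<in>{s - 1}. (\<delta> \<bullet> col R j) * (P *\<^sub>v w) $ j)"
      by (rule sum.mono_neutral_right) (use s_pos R(3) in auto)
    finally show ?thesis by simp
  qed
  \<comment> \<open>Testing \<open>form\<close> on this vector shows that its scalar factor is
    nonzero.\<close>
  have "\<delta> \<bullet> unit_vec s 0 = int (d 0)" using s_pos by simp
  then have "\<delta> \<bullet> col R (s - 1) \<noteq> 0" using form[of "unit_vec s 0"] d_pos[OF s_pos] by auto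
  then have "(P *\<^sub>v v) $ (s - 1) = 0" using form[OF v] assms(2) by simp
  then show ?thesis using v by (simp add: mem_iff)
qed

lemma torus_char_lattice:
  assumes \<zeta>: "\<zeta> \<in> root_tuples s \<gamma>" and a: "a \<in> \<L>"
  shows "torus_char s P \<zeta> a = 1"
  unfolding torus_char_def
proof (rule prod.neutral, rule ballI)
  fix j assume "j \<in> {..<s - 1}"
  then have j: "j < s - 1" by simp
  then obtain k where "(P *\<^sub>v a) $ j = int (\<gamma> j) * k" using a mem_iff by blast
  then show "\<zeta> j powi ((P *\<^sub>v a) $ j) = 1"
    using root_tuplesD(1)[OF \<zeta> j] by (simp add: power_int_mult)
qed

lemma primeideal_param_ideal: "primeideal (param_ideal s P d \<zeta>) (mpoly_ring s)"
  unfolding param_ideal_def param_hom_def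
  by (rule ring_hom_cring.primeideal_a_kernel[OF ring_hom_cring_mpoly_subst domain_class_ring])

lemma mem_param_ideal:
  "f \<in> param_ideal s P d \<zeta> \<longleftrightarrow> f \<in> carrier (mpoly_ring s) \<and> param_hom s P d \<zeta> f = 0"
  by (simp add: param_ideal_def mem_a_kernel_mpoly_ring)

text \<open>The two terms of a generator have equal degrees by orthogonality, and equal character
  values because characters from \<open>root_tuples\<close> are trivial on the lattice. Their images
  therefore cancel.\<close>

lemma lattice_ideal_subset:
  assumes \<zeta>: "\<zeta> \<in> root_tuples s \<gamma>"
  shows "lattice_ideal s \<L> \<subseteq> param_ideal s P d (\<zeta> :: nat \<Rightarrow> 'k::field)"
  unfolding lattice_ideal_def
proof (rule ring.genideal_minimal[OF cring.axioms(1)[OF mpoly_ring_cring]])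
  show "ideal (param_ideal s P d \<zeta>) (mpoly_ring s)"
    using primeideal_param_ideal by (rule primeideal.axioms(1))
  have sub: "\<L> \<subseteq> carrier_vec s" by (rule subgroup_monoid_vecD(1)[OF subgroup])
  show "{monomial (pos_part a) - monomial (pos_part (- a)) |a. a \<in> \<L>} \<subseteq> param_ideal s P d \<zeta>"
  proof clarify
    fix a assume a: "a \<in> \<L>"
    let ?p = "pos_part a" and ?n = "pos_part (- a)"
    have a': "a \<in> carrier_vec s" using sub a by blast
    have keys: "Poly_Mapping.keys ?p \<subseteq> {..<s}" "Poly_Mapping.keys ?n \<subseteq> {..<s}"
      using a' keys_pos_part[of a] keys_pos_part[of "- a"] by auto
    note decomp = exponent_vec_pos_part[OF a']
    have "int (weighted_degree d ?p) = int (weighted_degree d ?n)"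
      unfolding int_weighted_degree[OF keys(1)] int_weighted_degree[OF keys(2)] decomp
      using orthogonal[OF a] a' by (simp add: scalar_prod_add_distrib[of _ s])
    moreover have "torus_char s P \<zeta> (exponent_vec s ?p) = torus_char s P \<zeta> (exponent_vec s ?n)"
      unfolding decomp using torus_char_lattice[OF \<zeta> a] a' root_tuplesD(2)[OF \<zeta> _ pos]
      by (simp add: torus_char_add[OF P(1)])
    ultimately have "param_hom s P d \<zeta> (monomial ?p - monomial ?n) = 0"
      using param_hom_single[OF P(1) root_tuplesD(2)[OF \<zeta> _ pos] keys(1)]
        param_hom_single[OF P(1) root_tuplesD(2)[OF \<zeta> _ pos] keys(2)]
      by (simp add: param_hom_diff monomial_def)
    moreover have "monomial ?p - monomial ?n \<in> carrier (mpoly_ring s :: 'k mpoly ring)"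
      using lattice_generators_carrier[OF sub] a by blast
    ultimately show "monomial ?p - monomial ?n \<in> param_ideal s P d \<zeta>"
      by (simp add: mem_param_ideal)
  qed
qed

text \<open>
  For \<open>f\<close> in all the kernels, orthogonality of the characters isolates the sum of the coefficients
  of \<open>f\<close> over each single class modulo the lattice.
\<close>

lemma in_lattice_ideal_if_in_param_ideals:
  fixes f :: "'k::field mpoly"
  assumes card: "\<And>j. j < s - 1 \<Longrightarrow> card (roots_of_unity (\<gamma> j) :: 'k set) = \<gamma> j"
    and nz: "of_nat (\<Prod>j<s - 1. \<gamma> j) \<noteq> (0 :: 'k)"
    and f: "f \<in> carrier (mpoly_ring s)"
    and ker: "\<And>\<zeta> :: nat \<Rightarrow> 'k. \<zeta> \<in> root_tuples s \<gamma> \<Longrightarrow> f \<in> param_ideal s P d \<zeta>"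
  shows "f \<in> lattice_ideal s \<L>"
proof (rule in_lattice_ideal_if_class_sums_zero[OF subgroup f])
  let ?K = "Poly_Mapping.keys f" and ?e = "exponent_vec s"
  let ?\<Lambda> = "root_tuples s \<gamma> :: (nat \<Rightarrow> 'k) set"
  fix b assume b: "b \<in> ?K"
  \<comment> \<open>The terms that meet in one coefficient of \<open>param_hom\<close>. The whole
    class of \<open>b\<close> lies in this set, and inside it divisibility alone decides membership
    in the class.\<close>
  let ?D = "{c \<in> ?K. weighted_degree d c = weighted_degree d b}"
  have keys: "Poly_Mapping.keys c \<subseteq> {..<s}" if "c \<in> ?K" for c
    using f that by (simp add: mem_carrier_mpoly_ring)
  have degree: "weighted_degree d c = weighted_degree d b \<longleftrightarrow> \<delta> \<bullet> (?e c - ?e b) = 0"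
    if c: "c \<in> ?K" for c
    unfolding of_nat_eq_iff[where ?'a = int, symmetric] int_weighted_degree[OF keys[OF c]]
      int_weighted_degree[OF keys[OF b]]
    by (simp add: scalar_prod_minus_distrib[of _ s])
  have mem: "?e c - ?e b \<in> \<L> \<longleftrightarrow> c \<in> ?D \<and> (\<forall>j<s - 1. int (\<gamma> j) dvd (P *\<^sub>v (?e c - ?e b)) $ j)"
    if c: "c \<in> ?K" for c
    using c degree[OF c] orthogonal mem_iff_orthogonal[of "?e c - ?e b"] by auto
  \<comment> \<open>The vanishing coefficient of the image, divided by the nonzero character value
    at \<open>b\<close>, which shifts all exponents by that of \<open>b\<close>.\<close>
  have char_sum: "(\<Sum>c\<in>?D. Poly_Mapping.lookup f c * torus_char s P \<zeta> (?e c - ?e b)) = 0"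
    if \<zeta>: "\<zeta> \<in> ?\<Lambda>" for \<zeta>
  proof -
    note \<zeta>_nz = root_tuplesD(2)[OF \<zeta> _ pos]
    have shift: "torus_char s P \<zeta> (?e c - ?e b) * torus_char s P \<zeta> (?e b) = torus_char s P \<zeta> (?e c)" for c
    proof -
      have "?e c = (?e c - ?e b) + ?e b" by (rule eq_vecI) (auto simp: exponent_vec_def)
      then show ?thesis using torus_char_add[OF P(1), of "?e c - ?e b" "?e b" \<zeta>] \<zeta>_nz
        by (metis exponent_vec_carrier minus_carrier_vec)
    qed
    have "(\<Sum>c\<in>?D. Poly_Mapping.lookup f c * torus_char s P \<zeta> (?e c - ?e b))
        * torus_char s P \<zeta> (?e b) = (\<Sum>c\<in>?D. Poly_Mapping.lookup f c * torus_char s P \<zeta> (?e c))"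
      unfolding sum_distrib_right by (simp only: mult.assoc shift)
    also have "\<dots> = poly.coeff (param_hom s P d \<zeta> f) (weighted_degree d b)"
      by (rule coeff_param_hom[OF P(1) \<zeta>_nz f, symmetric])
    also have "\<dots> = 0" using ker[OF \<zeta>] by (simp add: mem_param_ideal)
    finally show ?thesis using torus_char_neq_0[of s \<zeta> P] \<zeta>_nz by auto
  qed
  have char_total: "(\<Sum>\<zeta>\<in>?\<Lambda>. torus_char s P \<zeta> (?e c - ?e b))
      = (if ?e c - ?e b \<in> \<L> then of_nat (\<Prod>j<s - 1. \<gamma> j) else 0)" if "c \<in> ?D" for c
  proof -
    have iff: "(\<forall>j<s - 1. int (\<gamma> j) dvd (P *\<^sub>v (?e c - ?e b)) $ j) \<longleftrightarrow> ?e c - ?e b \<in> \<L>"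
      using mem that by blast
    show ?thesis unfolding iff[symmetric] by (rule sum_torus_char[OF card pos])
  qed
  \<comment> \<open>Averaging over all tuples and swapping the sums leaves the class sum times the
    product of the \<gamma>'s, which is invertible in the field.\<close>
  have "0 = (\<Sum>\<zeta>\<in>?\<Lambda>. \<Sum>c\<in>?D. Poly_Mapping.lookup f c * torus_char s P \<zeta> (?e c - ?e b))"
    by (simp add: char_sum)
  also have "\<dots> = (\<Sum>c\<in>?D. Poly_Mapping.lookup f c * (\<Sum>\<zeta>\<in>?\<Lambda>. torus_char s P \<zeta> (?e c - ?e b)))"
    unfolding sum_distrib_left by (rule sum.swap)
  also have "\<dots> = (\<Sum>c\<in>?D. if ?e c - ?e b \<in> \<L>
      then Poly_Mapping.lookup f c * of_nat (\<Prod>j<s - 1. \<gamma> j) else 0)"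
    by (intro sum.cong refl) (simp add: char_total)
  also have "\<dots> = (\<Sum>c\<in>{c \<in> ?D. ?e c - ?e b \<in> \<L>}. Poly_Mapping.lookup f c)
      * of_nat (\<Prod>j<s - 1. \<gamma> j)"
    unfolding sum_distrib_right by (rule sum.inter_filter[symmetric]) simp
  also have "{c \<in> ?D. ?e c - ?e b \<in> \<L>} = {c \<in> ?K. ?e c - ?e b \<in> \<L>}" using mem by blast
  finally show "(\<Sum>c\<in>{c \<in> ?K. ?e c - ?e b \<in> \<L>}. Poly_Mapping.lookup f c) = 0" using nz by simp
qed

text \<open>The dual vector \<open>u = col R j\<close> has degree 0 and character value
  \<open>\<zeta> j\<close>, so a binomial with exponents \<open>u\<^sup>+\<close> and
  \<open>u\<^sup>-\<close> detects the \<open>j\<close>-th coordinate.\<close>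

lemma param_ideal_subset_imp_eq:
  fixes \<zeta> \<eta> :: "nat \<Rightarrow> 'k::field"
  assumes \<zeta>: "\<zeta> \<in> root_tuples s \<gamma>" and \<eta>: "\<eta> \<in> root_tuples s \<gamma>"
    and sub: "param_ideal s P d \<zeta> \<subseteq> param_ideal s P d \<eta>"
  shows "\<zeta> = \<eta>"
\<comment> \<open>Tuples are extensional, so only indices below \<open>s - 1\<close> have to be
  compared.\<close>
proof (rule PiE_ext[OF \<zeta>[unfolded root_tuples_def] \<eta>[unfolded root_tuples_def]])
  fix j assume "j \<in> {..<s - 1}"
  then have j: "j < s - 1" by simp
  obtain R where R: "R \<in> carrier_mat s s" "P *\<^sub>v col R j = unit_vec s j" "\<delta> \<bullet> col R j = 0"
    using dual_basis j by (metis less_imp_diff_less less_diff_conv2 less_le_trans diff_le_self)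
  define u where "u = col R j"
  have u: "u \<in> carrier_vec s"
    unfolding u_def by (rule col_carrier_vec[OF _ R(1)]) (use j in simp)
  let ?p = "pos_part u" and ?n = "pos_part (- u)" and ?\<chi> = "torus_char s P"
  \<comment> \<open>The crossed coefficients make the two images under \<xi> cancel.\<close>
  let ?f = "\<lambda>\<xi>. Poly_Mapping.single ?p (?\<chi> \<xi> (exponent_vec s ?n))
    - Poly_Mapping.single ?n (?\<chi> \<xi> (exponent_vec s ?p))"
  have keys: "Poly_Mapping.keys ?p \<subseteq> {..<s}" "Poly_Mapping.keys ?n \<subseteq> {..<s}"
    using u keys_pos_part[of u] keys_pos_part[of "- u"] by auto
  note decomp = exponent_vec_pos_part[OF u]
  have "int (weighted_degree d ?p) = int (weighted_degree d ?n)"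
    unfolding int_weighted_degree[OF keys(1)] int_weighted_degree[OF keys(2)] decomp
    using R(3) u unfolding u_def[symmetric] by (simp add: scalar_prod_add_distrib[of _ s])
  then have deg: "weighted_degree d ?p = weighted_degree d ?n" by simp
  \<comment> \<open>Both terms have the same degree, so the image is one monomial whose coefficient
    is a 2 by 2 determinant of character values; it vanishes at \<eta> exactly when the
    \<open>j\<close>-th coordinates agree.\<close>
  have image: "param_hom s P d \<xi> (?f \<zeta>) = monom (?\<chi> \<zeta> (exponent_vec s ?n) * ?\<chi> \<xi> (exponent_vec s ?p)
      - ?\<chi> \<zeta> (exponent_vec s ?p) * ?\<chi> \<xi> (exponent_vec s ?n)) (weighted_degree d ?n)"
    if "\<xi> \<in> root_tuples s \<gamma>" for \<xi> :: "nat \<Rightarrow> 'k"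
    unfolding diff_monom[symmetric] deg[symmetric]
    using param_hom_single[OF P(1) root_tuplesD(2)[OF that _ pos] keys(1)]
      param_hom_single[OF P(1) root_tuplesD(2)[OF that _ pos] keys(2)] deg
    by (simp add: param_hom_diff)
  have "?f \<zeta> \<in> carrier (mpoly_ring s)"
    unfolding mem_carrier_mpoly_ring using keys
      keys_diff[of "Poly_Mapping.single ?p (?\<chi> \<zeta> (exponent_vec s ?n))"
        "Poly_Mapping.single ?n (?\<chi> \<zeta> (exponent_vec s ?p))"]
    by (fastforce split: if_splits)
  then have "?f \<zeta> \<in> param_ideal s P d \<zeta>"
    using image[OF \<zeta>] by (simp add: mem_param_ideal mult.commute)
  then have "?\<chi> \<zeta> (exponent_vec s ?n) * ?\<chi> \<eta> (exponent_vec s ?p)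
      = ?\<chi> \<zeta> (exponent_vec s ?p) * ?\<chi> \<eta> (exponent_vec s ?n)"
    using sub image[OF \<eta>] by (auto simp: mem_param_ideal)
  moreover have char_decomp: "?\<chi> \<xi> (exponent_vec s ?p) = \<xi> j * ?\<chi> \<xi> (exponent_vec s ?n)"
    and char_nz: "?\<chi> \<xi> (exponent_vec s ?n) \<noteq> 0"
    if \<xi>: "\<xi> \<in> root_tuples s \<gamma>" for \<xi> :: "nat \<Rightarrow> 'k"
  proof -
    note nz = root_tuplesD(2)[OF \<xi> _ pos]
    have "?\<chi> \<xi> u = (\<Prod>i<s - 1. if i = j then \<xi> j else 1)"
      unfolding torus_char_def u_def R(2) by (intro prod.cong) (use j in auto)
    also have "\<dots> = \<xi> j" using j by simp
    finally have "?\<chi> \<xi> u = \<xi> j" .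
    moreover have "?\<chi> \<xi> (u + exponent_vec s ?n) = ?\<chi> \<xi> u * ?\<chi> \<xi> (exponent_vec s ?n)"
      by (rule torus_char_add[OF P(1) u exponent_vec_carrier nz])
    ultimately show "?\<chi> \<xi> (exponent_vec s ?p) = \<xi> j * ?\<chi> \<xi> (exponent_vec s ?n)"
      by (simp only: decomp)
    show "?\<chi> \<xi> (exponent_vec s ?n) \<noteq> 0" by (rule torus_char_neq_0[OF nz])
  qed
  ultimately show "\<zeta> j = \<eta> j"
    using char_decomp[OF \<zeta>] char_decomp[OF \<eta>] char_nz[OF \<zeta>] char_nz[OF \<eta>] by auto
qed

end

text \<open>For uniqueness a competing decomposition is a set of ideals indexed by itself. The count
  is taken on the image of \<Lambda> under \<aa>, so it counts distinct components and includes
  injectivity.\<close>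

theorem theorem3p3:
  fixes s m :: nat
    and \<L> :: "int vec set"
    and L P Q :: "int mat"
    and \<gamma> d :: "nat \<Rightarrow> nat"
  assumes s: "s \<ge> 2"
    and lattice: "subgroup \<L> (monoid_vec TYPE(int) s)" "lattice_rank s \<L> = s - 1"
    and generators: "L \<in> carrier_mat s m" "\<L> = generate (monoid_vec TYPE(int) s) (set (cols L))"
    and P: "P \<in> carrier_mat s s" "invertible_mat P"
    and Q: "Q \<in> carrier_mat m m" "invertible_mat Q"
    and smith: "P * L * Q = smith_diag s m \<gamma>"
    and gamma_pos: "\<And>i. i < s - 1 \<Longrightarrow> \<gamma> i > 0"
    and gamma_dvd: "\<And>i j. i \<le> j \<Longrightarrow> j < s - 1 \<Longrightarrow> \<gamma> i dvd \<gamma> j"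
    and roots: "contains_roots_of_unity TYPE('k::field) (\<gamma> (s - 2))"
    and char: "CHAR('k) = 0 \<or> prime CHAR('k) \<and> \<not> CHAR('k) dvd \<gamma> (s - 2)"
    and d_pos: "\<And>i. i < s \<Longrightarrow> d i > 0"
    and d_gcd: "Gcd (d ` {..<s}) = 1"
    and graded: "graded_ideal s d (lattice_ideal s \<L> :: 'k mpoly set)"
  defines "I \<equiv> (lattice_ideal s \<L> :: 'k mpoly set)"
    and "\<Lambda> \<equiv> (root_tuples s \<gamma> :: (nat \<Rightarrow> 'k) set)"
    and "\<aa> \<equiv> (param_ideal s P d :: (nat \<Rightarrow> 'k) \<Rightarrow> 'k mpoly set)"
  shows "I = (\<Inter>\<zeta>\<in>\<Lambda>. \<aa> \<zeta>) \<and>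
    minimal_primary_decomposition (mpoly_ring s) I \<Lambda> \<aa> \<and>
    (\<forall>\<Q>. minimal_primary_decomposition (mpoly_ring s) I \<Q> (\<lambda>q. q) \<longrightarrow> \<Q> = \<aa> ` \<Lambda>) \<and>
    card (\<aa> ` \<Lambda>) = (\<Prod>i<s - 1. \<gamma> i)"
proof -
  have \<L>: "\<L> = {L *\<^sub>v z | z. z \<in> carrier_vec m}"
    unfolding generators(2) by (rule generate_cols[OF generators(1)])
  then have m: "s - 1 \<le> m"
    using lattice_rank_le[OF generators(1)] lattice(2) by simp
  have mem_iff: "a \<in> \<L> \<longleftrightarrow> a \<in> carrier_vec s \<and>
      (\<forall>j<s - 1. int (\<gamma> j) dvd (P *\<^sub>v a) $ j) \<and> (P *\<^sub>v a) $ (s - 1) = 0" for a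
    unfolding \<L>
    by (rule mem_smith_lattice_iff[OF generators(1) P Q smith m _ gamma_pos]) (use s in simp_all)
  have sub: "\<L> \<subseteq> carrier_vec s" by (rule subgroup_monoid_vecD(1)[OF lattice(1)])
  interpret graded_lattice s \<L> P \<gamma> d
  proof (rule graded_lattice.intro)
    show "s > 0" using s by simp
  qed (rule lattice(1) P gamma_pos mem_iff d_pos graded_lattice_ideal_orthogonal[OF sub graded];
      assumption)+
  interpret R: cring "mpoly_ring s :: 'k mpoly ring" by (rule mpoly_ring_cring)
  have dvd: "\<gamma> j dvd \<gamma> (s - 2)" if "j < s - 1" for j
    by (rule gamma_dvd) (use that s in simp_all)
  \<comment> \<open>Settles characteristic 0, where divisibility by \<open>CHAR('k)\<close> would
    mean being 0.\<close>
  have "\<gamma> (s - 2) > 0" by (rule gamma_pos) (use s in simp)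
  then have char_dvd: "\<not> CHAR('k) dvd \<gamma> (s - 2)" using char by auto
  then have nz: "of_nat (\<gamma> (s - 2)) \<noteq> (0::'k)" by (simp add: of_nat_eq_0_iff_char_dvd)
  have card: "card (roots_of_unity (\<gamma> j) :: 'k set) = \<gamma> j" if "j < s - 1" for j
    by (rule card_roots_of_unity[OF roots nz dvd[OF that]])
  have "of_nat (\<gamma> j) \<noteq> (0::'k)" if "j < s - 1" for j
    using char_dvd dvd[OF that] dvd_trans by (auto simp: of_nat_eq_0_iff_char_dvd)
  then have nz_prod: "of_nat (\<Prod>j<s - 1. \<gamma> j) \<noteq> (0::'k)" by (simp add: of_nat_prod)
  have fin: "finite \<Lambda>"
    unfolding \<Lambda>_def root_tuples_def by (intro finite_PiE) (simp_all add: finite_roots_of_unity gamma_pos)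
  have card_\<Lambda>: "card \<Lambda> = (\<Prod>i<s - 1. \<gamma> i)"
    unfolding \<Lambda>_def root_tuples_def by (simp add: card_PiE card)
  \<comment> \<open>Nonemptiness of \<Lambda> keeps the plain intersection inside the carrier; an
    empty one would be the whole type.\<close>
  have "0 < (\<Prod>i<s - 1. \<gamma> i)" by (rule prod_pos) (use gamma_pos in simp)
  then have "\<Lambda> \<noteq> {}" unfolding card_\<Lambda>[symmetric] by auto
  have prime: "primeideal (\<aa> \<zeta>) (mpoly_ring s)" for \<zeta>
    unfolding \<aa>_def by (rule primeideal_param_ideal)
  have incomp: "\<zeta> = \<eta>" if "\<zeta> \<in> \<Lambda>" "\<eta> \<in> \<Lambda>" "\<aa> \<zeta> \<subseteq> \<aa> \<eta>" for \<zeta> \<eta>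
    using that unfolding \<aa>_def \<Lambda>_def by (rule param_ideal_subset_imp_eq)
  have carrier: "\<aa> \<zeta> \<subseteq> carrier (mpoly_ring s)" for \<zeta>
    unfolding \<aa>_def by (auto simp: mem_param_ideal)
  have lower: "I \<subseteq> \<aa> \<zeta>" if "\<zeta> \<in> \<Lambda>" for \<zeta>
    using that unfolding I_def \<aa>_def \<Lambda>_def by (rule lattice_ideal_subset)
  have upper: "f \<in> I" if "f \<in> carrier (mpoly_ring s)" "\<And>\<zeta>. \<zeta> \<in> \<Lambda> \<Longrightarrow> f \<in> \<aa> \<zeta>" for f
    unfolding I_def
  proof (rule in_lattice_ideal_if_in_param_ideals[OF card nz_prod that(1)])
    show "f \<in> param_ideal s P d \<zeta>" if "\<zeta> \<in> root_tuples s \<gamma>" for \<zeta> :: "nat \<Rightarrow> 'k"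
      using \<open>\<And>\<zeta>. \<zeta> \<in> \<Lambda> \<Longrightarrow> f \<in> \<aa> \<zeta>\<close>[of \<zeta>] that unfolding \<aa>_def \<Lambda>_def .
  qed
  obtain \<zeta>\<^sub>0 where \<zeta>\<^sub>0: "\<zeta>\<^sub>0 \<in> \<Lambda>" using \<open>\<Lambda> \<noteq> {}\<close> by blast
  have INT_carrier: "(\<Inter>\<zeta>\<in>\<Lambda>. \<aa> \<zeta>) \<subseteq> carrier (mpoly_ring s)"
    by (rule INF_lower2[OF \<zeta>\<^sub>0 carrier])
  have I: "I = (\<Inter>\<zeta>\<in>\<Lambda>. \<aa> \<zeta>)"
  proof (rule equalityI)
    show "I \<subseteq> (\<Inter>\<zeta>\<in>\<Lambda>. \<aa> \<zeta>)" by (rule INT_greatest) (rule lower)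
    show "(\<Inter>\<zeta>\<in>\<Lambda>. \<aa> \<zeta>) \<subseteq> I"
      by (rule subsetI, rule upper, rule subsetD[OF INT_carrier], assumption, erule INT_D)
  qed
  then have I': "I = carrier (mpoly_ring s) \<inter> (\<Inter>\<zeta>\<in>\<Lambda>. \<aa> \<zeta>)"
    unfolding Int_absorb1[OF INT_carrier] .
  have decomposition: "minimal_primary_decomposition (mpoly_ring s) I \<Lambda> \<aa>"
    unfolding I' by (rule R.minimal_primary_decomposition_primeideals[OF fin prime incomp])
  have unique: "\<Q> = \<aa> ` \<Lambda>"
    if "minimal_primary_decomposition (mpoly_ring s) I \<Q> (\<lambda>q. q)" for \<Q>
    by (rule R.minimal_primary_decomposition_unique[OF fin prime incomp that[unfolded I']])
  have "inj_on \<aa> \<Lambda>" by (rule inj_onI) (rule incomp, assumption+, simp)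
  then have count: "card (\<aa> ` \<Lambda>) = (\<Prod>i<s - 1. \<gamma> i)"
    unfolding card_\<Lambda>[symmetric] by (rule card_image)
  show ?thesis by (intro conjI allI impI I decomposition unique count)
qed

end
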